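(* Suppose $U$ satisfies Assumption 1. Then for all $0\le\alpha\le\alpha'(U)$, $$\lim_{\eta\downarrow0}\mathsf{RS}(\alpha;U_\eta)=\mathsf{RS}(\alpha;U),\qquad\text{where }\ \alpha'(U)=\frac{1}{e^{16}\,c_1\,C_1(U)^6\,(K_2)'(U)^4}.$$
   Context: $\xi,\xi',Z$ are independent standard Gaussian random variables, $\varphi$ is the standard Gaussian density, $\mathbb E_\xi$ is expectation over $\xi$ only, $\mathrm{th}=\tanh$, $\mathrm{ch}=\cosh$. Assumption 1: $U:\mathbb R\to[0,1]$ is measurable and $\mathbb E_\xi[\xi U(\xi)]\ne0$. For $\eta>0$, $U_\eta(x)=\mathbb E_\xi U(x+\eta\xi)$; this satisfies Assumption 1 for $\eta$ small enough. $(K_2)'(U)=\max\Big\{1,\sup\Big\{\frac{\mathbb E_{\xi,\xi'}[(\xi-\xi')^2U(x+c\xi)U(x+c\xi')]}{\mathbb E_{\xi,\xi'}[U(x+c\xi)U(x+c\xi')]}:x\in\mathbb R,\ \tfrac25\le c\le\tfrac73\Big\}\Big\}$; if this is infinite, $\alpha'(U)$ is understood as $0$. For $q\in[0,1)$: $L_q(x)=\log\mathbb E_\xi U(x+(1-q)^{1/2}\xi)$ and $F_q=(L_q)'$ (these depend on $U$). Constants. $\bar c_1(U)=\max\{2,\sup\{1/\mathbb E_\xi U(c\xi):\frac12\le c\le2\}\}<\infty$, $K_0(U)=(8\log\bar c_1(U))^{1/2}$, $C_1(U)=(4K_0(U))^{200}+c_0\,\bar c_1(U)\ge10$, where $c_0\ge5$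 is a fixed absolute constant such that $\mathbb E(|\xi|^p;|\xi|\ge m)\le c_0\,\varphi(m/1.05)/(m/1.05)$ for all $m>0$, $0\le p\le200$. $c_1\ge1$ is a fixed absolute constant such that for every $U$ satisfying Assumption 1, $\sup_{0\le q\le1/2}|\frac{d}{dq}\mathbb E[F_q(q^{1/2}Z)^2]|\le c_1C_1(U)^6$ and $\sup_{0\le q\le1/2}|\frac{d}{dq}\mathbb E[L_q(q^{1/2}Z)]|\le c_1C_1(U)^2$. Replica symmetric formula: $\mathsf{RS}(\alpha;U)=-\frac{\psi(1-q)}2+\mathbb E\{\log(2\,\mathrm{ch}(\psi^{1/2}Z))+\alpha L_q(q^{1/2}Z)\}$, where $(q,\psi)$ is the unique pair in $[0,1/25]\times[0,\infty)$ with $q=\mathbb E[\mathrm{th}(\psi^{1/2}Z)^2]$ and $\psi=\alpha\,\mathbb E[F_q(q^{1/2}Z)^2]$. For $0\le\alpha\le\alpha'(U)$ this pair exists and is unique for $U$, and also for $U_\eta$ in place of $U$ for all sufficiently small $\eta>0$. *)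

theory Defs
  imports "HOL-Probability.Probability"
begin

text \<open>
  Expectations over \<open>\<xi>\<close> or \<open>Z\<close> are integrals against \<^term>\<open>std_normal_distribution\<close>, those over
  an independent pair \<open>(\<xi>, \<xi>')\<close> against its product with itself.
\<close>

definition assumption1 :: "(real \<Rightarrow> real) \<Rightarrow> bool" where
  "assumption1 U \<longleftrightarrow>
     U \<in> borel_measurable borel \<and> (\<forall>x. 0 \<le> U x \<and> U x \<le> 1) \<and>
     (\<integral>\<xi>. \<xi> * U \<xi> \<partial>std_normal_distribution) \<noteq> 0"

definition smoothed :: "real \<Rightarrow> (real \<Rightarrow> real) \<Rightarrow> real \<Rightarrow> real" where
  "smoothed \<eta> U x = (\<integral>\<xi>. U (x + \<eta> * \<xi>) \<partial>std_normal_distribution)"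

definition L :: "(real \<Rightarrow> real) \<Rightarrow> real \<Rightarrow> real \<Rightarrow> real" where
  "L U q x = ln (\<integral>\<xi>. U (x + sqrt (1 - q) * \<xi>) \<partial>std_normal_distribution)"

definition F :: "(real \<Rightarrow> real) \<Rightarrow> real \<Rightarrow> real \<Rightarrow> real" where
  "F U q = deriv (L U q)"

text \<open>
  The supremum defining \<open>(K\<^sub>2)'\<close> may be infinite, hence the extended reals. The supremum in
  \<open>c1_bar\<close> is always finite under \<^const>\<open>assumption1\<close>, so it is taken in the reals.
\<close>

definition K2' :: "(real \<Rightarrow> real) \<Rightarrow> ereal" where
  "K2' U = max 1 (Sup {ereal
      ((\<integral>(\<xi>, \<xi>'). (\<xi> - \<xi>')\<^sup>2 * U (x + c * \<xi>) * U (x + c * \<xi>')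
           \<partial>(std_normal_distribution \<Otimes>\<^sub>M std_normal_distribution)) /
       (\<integral>(\<xi>, \<xi>'). U (x + c * \<xi>) * U (x + c * \<xi>')
           \<partial>(std_normal_distribution \<Otimes>\<^sub>M std_normal_distribution)))
      | x c. 2/5 \<le> c \<and> c \<le> 7/3})"

definition c1_bar :: "(real \<Rightarrow> real) \<Rightarrow> real" where
  "c1_bar U = max 2 (SUP c\<in>{1/2..2}. 1 / (\<integral>\<xi>. U (c * \<xi>) \<partial>std_normal_distribution))"

definition K0 :: "(real \<Rightarrow> real) \<Rightarrow> real" where
  "K0 U = sqrt (8 * ln (c1_bar U))"

definition C1 :: "real \<Rightarrow> (real \<Rightarrow> real) \<Rightarrow> real" where
  "C1 c0 U = (4 * K0 U) ^ 200 + c0 * c1_bar U"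

text \<open>
  The absolute constants \<open>c\<^sub>0\<close> and \<open>c\<^sub>1\<close> are not given explicitly; they may be any constants with
  the following properties. The exponent \<open>p\<close> is real.
\<close>

definition admissible_c0 :: "real \<Rightarrow> bool" where
  "admissible_c0 c0 \<longleftrightarrow> 5 \<le> c0 \<and>
     (\<forall>m p. 0 < m \<longrightarrow> 0 \<le> p \<longrightarrow> p \<le> 200 \<longrightarrow>
        (\<integral>\<xi>. \<bar>\<xi>\<bar> powr p * indicator {\<xi>. m \<le> \<bar>\<xi>\<bar>} \<xi> \<partial>std_normal_distribution)
          \<le> c0 * (std_normal_density (m / 1.05) / (m / 1.05)))"

text \<open>
  The derivatives in \<open>q\<close> are those of functions on \<open>[0,1)\<close>, hence one-sided at \<open>q = 0\<close>.
\<close>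

definition admissible_c1 :: "real \<Rightarrow> real \<Rightarrow> bool" where
  "admissible_c1 c0 c1 \<longleftrightarrow> 1 \<le> c1 \<and>
     (\<forall>U. assumption1 U \<longrightarrow> (\<forall>q\<in>{0..1/2}.
        (\<exists>D. ((\<lambda>q. \<integral>z. (F U q (sqrt q * z))\<^sup>2 \<partial>std_normal_distribution)
                 has_real_derivative D) (at q within {0..<1})
             \<and> \<bar>D\<bar> \<le> c1 * C1 c0 U ^ 6) \<and>
        (\<exists>D. ((\<lambda>q. \<integral>z. L U q (sqrt q * z) \<partial>std_normal_distribution)
                 has_real_derivative D) (at q within {0..<1})
             \<and> \<bar>D\<bar> \<le> c1 * C1 c0 U ^ 2)))"

definition alpha' :: "real \<Rightarrow> real \<Rightarrow> (real \<Rightarrow> real) \<Rightarrow> real" where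
  "alpha' c0 c1 U =
     (if K2' U = \<infinity> then 0
      else 1 / (exp 16 * c1 * C1 c0 U ^ 6 * real_of_ereal (K2' U) ^ 4))"

definition is_rs_pair :: "real \<Rightarrow> (real \<Rightarrow> real) \<Rightarrow> real \<Rightarrow> real \<Rightarrow> bool" where
  "is_rs_pair \<alpha> U q \<psi> \<longleftrightarrow>
     0 \<le> q \<and> q \<le> 1/25 \<and> 0 \<le> \<psi> \<and>
     q = (\<integral>z. (tanh (sqrt \<psi> * z))\<^sup>2 \<partial>std_normal_distribution) \<and>
     \<psi> = \<alpha> * (\<integral>z. (F U q (sqrt q * z))\<^sup>2 \<partial>std_normal_distribution)"

definition RS :: "real \<Rightarrow> (real \<Rightarrow> real) \<Rightarrow> real" where
  "RS \<alpha> U =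
     (let (q, \<psi>) = (THE (q, \<psi>). is_rs_pair \<alpha> U q \<psi>)
      in - (\<psi> * (1 - q)) / 2
         + (\<integral>z. ln (2 * cosh (sqrt \<psi> * z)) + \<alpha> * L U q (sqrt q * z) \<partial>std_normal_distribution))"

end

theory Submission imports Defs begin

text \<open>
  The pair \<open>(q, \<psi>)\<close> in the replica symmetric formula is the fixed point of a contraction, and
  smoothing \<open>U\<close> perturbs this contraction continuously.

  Eliminating \<open>\<psi>\<close> leaves the equation \<open>q = P (\<alpha> G q)\<close>, where \<open>P \<psi>\<close> is the mean of \<open>tanh\<^sup>2\<close> under a
  Gaussian of variance \<open>\<psi>\<close> and \<open>G q\<close> is the mean of \<open>F\<^sub>q\<^sup>2\<close>. The function \<open>P\<close> is 1-Lipschitz, because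
  \<open>tanh\<^sup>2\<close> is 1-Lipschitz as a function of the square of its argument
  (\<open>tanh_square_lipschitz\<close>, \<open>gaussian_mean_lipschitz\<close>). By the choice of \<open>c1\<close>, \<open>G\<close> has Lipschitz
  constant \<open>c1 C1\<^sup>6\<close>, and \<open>G 0 \<le> C1\<^sup>2\<close>. As \<open>\<alpha> c1 C1\<^sup>6 \<le> exp (-16)\<close>, the right-hand side is a contraction of
  \<open>{0..1/25}\<close> into itself (\<open>rs_overlap_ex1\<close>). This leaves room for \<open>C1\<close> to double, so for small \<open>\<eta>\<close> the same
  argument, with the same \<open>\<alpha>\<close>, applies to the smoothed function (\<open>eventually_C1_smoothed_le\<close>). The two fixed points
  differ by at most twice the difference of the two maps at the fixed point for \<open>U\<close>
  (\<open>tendsto_rs_overlap\<close>), and since all the maps involved are Lipschitz with uniform constants, the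
  theorem reduces to convergence of the means of \<open>F\<^sub>q\<^sup>2\<close> and \<open>L\<^sub>q\<close> at this one fixed value of \<open>q\<close>.

  For the latter, both \<open>exp L\<^sub>q\<close> and the smoothed function are Gaussian averages of \<open>U\<close>, and Gaussian averages
  compose (\<open>smoothed_smoothed\<close>): passing to the smoothed function merely changes the width
  \<open>sqrt (1 - q)\<close> into \<open>sqrt (1 - q + \<eta>\<^sup>2)\<close>. Averages of \<open>U\<close> and their derivatives depend continuously on
  the width, and the bound \<open>smoothed_gaussian_lower_bound\<close> keeps the logarithm and the quotient
  dominated by integrable functions, the latter because \<open>q\<close> is small (\<open>tendsto_mean_L_mean_F2\<close>).
\<close>

section \<open>Limits and derivatives of dominated integrals\<close>

text \<open>
  Dominated convergence for a real parameter reduces to its sequential form because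
  limits along \<^term>\<open>at a within S\<close> are detected by sequences.
\<close>
lemma tendsto_integral_dominated_within:
  fixes f :: "real \<Rightarrow> 'a \<Rightarrow> real"
  assumes meas: "\<And>t. t \<in> S \<Longrightarrow> f t \<in> borel_measurable M" "l \<in> borel_measurable M"
    and lim: "\<And>y. y \<in> space M \<Longrightarrow> ((\<lambda>t. f t y) \<longlongrightarrow> l y) (at a within S)"
    and bound: "\<And>t y. t \<in> S \<Longrightarrow> y \<in> space M \<Longrightarrow> \<bar>f t y\<bar> \<le> g y"
    and g: "integrable M g"
  shows "((\<lambda>t. \<integral>y. f t y \<partial>M) \<longlongrightarrow> (\<integral>y. l y \<partial>M)) (at a within S)"
  unfolding tendsto_at_iff_sequentially
proof (intro allI impI)
  fix X :: "nat \<Rightarrow> real"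
  assume X: "\<forall>i. X i \<in> S - {a}" "X \<longlonglongrightarrow> a"
  have "(\<lambda>n. f (X n) y) \<longlonglongrightarrow> l y" if "y \<in> space M" for y
    using lim[OF that] X unfolding tendsto_at_iff_sequentially by (auto simp: comp_def)
  then show "((\<lambda>t. \<integral>y. f t y \<partial>M) \<circ> X) \<longlonglongrightarrow> (\<integral>y. l y \<partial>M)"
    unfolding comp_def using X(1) meas bound g
    by (intro integral_dominated_convergence[where w=g]) auto
qed

text \<open>
  By the mean value inequality the difference quotients inherit the bound \<open>g\<close> on the
  derivatives, so dominated convergence applies to them.
\<close>
lemma has_real_derivative_integral_dominated:
  fixes f :: "real \<Rightarrow> 'a \<Rightarrow> real"
  assumes deriv: "\<And>t y. t \<in> {a<..<b} \<Longrightarrow> y \<in> space M \<Longrightarrow>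
      ((\<lambda>t. f t y) has_real_derivative f' t y) (at t)"
    and int: "\<And>t. t \<in> {a<..<b} \<Longrightarrow> integrable M (f t)"
    and bound: "\<And>t y. t \<in> {a<..<b} \<Longrightarrow> y \<in> space M \<Longrightarrow> \<bar>f' t y\<bar> \<le> g y"
    and g: "integrable M g" and f': "f' x \<in> borel_measurable M" and x: "x \<in> {a<..<b}"
  shows "((\<lambda>t. \<integral>y. f t y \<partial>M) has_real_derivative (\<integral>y. f' x y \<partial>M)) (at x)"
proof -
  have at: "at x within {a<..<b} = at x"
    using x by (intro at_within_open) auto
  have "((\<lambda>t. \<integral>y. (f t y - f x y) / (t - x) \<partial>M) \<longlongrightarrow> (\<integral>y. f' x y \<partial>M)) (at x within {a<..<b})"
  proof (rule tendsto_integral_dominated_within)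
    show "(\<lambda>y. (f t y - f x y) / (t - x)) \<in> borel_measurable M" if "t \<in> {a<..<b}" for t
      using int[OF that] int[OF x] by measurable
    show "((\<lambda>t. (f t y - f x y) / (t - x)) \<longlongrightarrow> f' x y) (at x within {a<..<b})" if "y \<in> space M" for y
      using deriv[OF x that] unfolding at has_field_derivative_iff .
    show "\<bar>(f t y - f x y) / (t - x)\<bar> \<le> g y" if t: "t \<in> {a<..<b}" and y: "y \<in> space M" for t y
    proof -
      have "norm (f t y - f x y) \<le> g y * norm (t - x)"
        using t x y by (intro field_differentiable_bound[where S="{a<..<b}"])
          (auto intro!: bound has_field_derivative_at_within[OF deriv])
      moreover have "0 \<le> g y"
        using bound[OF x y] by linarith
      ultimately show ?thesis
        by (cases "t = x") (auto simp: abs_divide divide_le_eq)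
    qed
  qed (use g f' in auto)
  moreover have "\<forall>\<^sub>F t in at x within {a<..<b}.
      (\<integral>y. (f t y - f x y) / (t - x) \<partial>M) = ((\<integral>y. f t y \<partial>M) - (\<integral>y. f x y \<partial>M)) / (t - x)"
    unfolding eventually_at_filter using int x by (intro always_eventually) (auto simp: Bochner_Integration.integral_diff)
  ultimately show ?thesis
    unfolding has_field_derivative_iff at[symmetric] by (subst tendsto_cong[symmetric])
qed

section \<open>Gaussian smoothing\<close>

text \<open>
  This is the derivative of \<open>smoothed \<sigma> U\<close> in the form given by Gaussian integration by parts,
  which makes sense for discontinuous \<open>U\<close>.
\<close>
definition smoothed_slope :: "real \<Rightarrow> (real \<Rightarrow> real) \<Rightarrow> real \<Rightarrow> real" where
  "smoothed_slope \<sigma> U x = (\<integral>\<xi>. \<xi> * U (x + \<sigma> * \<xi>) \<partial>std_normal_distribution) / \<sigma>"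

text \<open>
  The part of \<^const>\<open>assumption1\<close> that smoothing preserves for every width; the condition on the mean
  is guaranteed only for small widths.
\<close>
definition unit_valued :: "(real \<Rightarrow> real) \<Rightarrow> bool" where
  "unit_valued U \<longleftrightarrow> U \<in> borel_measurable borel \<and> (\<forall>x. 0 \<le> U x \<and> U x \<le> 1)"

text \<open>
  Moving the parameters from the argument of \<open>f\<close> into the Gaussian density is what gives
  regularity in \<open>x\<close> and \<open>\<sigma>\<close>: the density is smooth in them, while \<open>f\<close> is only measurable.
\<close>
lemma integral_std_normal_rescale:
  assumes [measurable]: "f \<in> borel_measurable borel" and [arith]: "\<sigma> > 0"
  shows "(\<integral>\<xi>. f (x + \<sigma> * \<xi>) \<partial>std_normal_distribution) = (\<integral>y. normal_density x \<sigma> y * f y \<partial>lborel)"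
proof -
  have "normal_density x \<sigma> (x + \<sigma> * \<xi>) * \<sigma> = std_normal_density \<xi>" for \<xi>
    by (simp add: normal_density_def real_sqrt_mult power_mult_distrib field_simps)
  then have *: "normal_density x \<sigma> (x + \<sigma> * \<xi>) * (\<sigma> * c) = std_normal_density \<xi> * c" for \<xi> c
    by (metis mult.assoc)
  show ?thesis
    by (subst integral_density, simp, simp, simp, subst lborel_integral_real_affine[where c=\<sigma> and t=x])
       (simp_all add: * mult.left_commute[of \<sigma>] flip: integral_mult_right_zero)
qed

lemma smoothed_density:
  assumes "unit_valued U" "\<sigma> > 0"
  shows "smoothed \<sigma> U x = (\<integral>y. normal_density x \<sigma> y * U y \<partial>lborel)"
  using assms unfolding smoothed_def unit_valued_def by (simp add: integral_std_normal_rescale)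

lemma smoothed_slope_density:
  assumes "unit_valued U" "\<sigma> > 0"
  shows "smoothed_slope \<sigma> U x = (\<integral>y. normal_density x \<sigma> y * ((y - x) / \<sigma>\<^sup>2 * U y) \<partial>lborel)"
proof -
  have [measurable]: "U \<in> borel_measurable borel"
    using assms by (simp add: unit_valued_def)
  have "(\<integral>\<xi>. \<xi> / \<sigma> * U (x + \<sigma> * \<xi>) \<partial>std_normal_distribution) =
     (\<integral>\<xi>. (((x + \<sigma> * \<xi>) - x) / \<sigma>\<^sup>2 * U (x + \<sigma> * \<xi>)) \<partial>std_normal_distribution)"
    using assms(2) by (simp add: power2_eq_square)
  also have "\<dots> = (\<integral>y. normal_density x \<sigma> y * ((y - x) / \<sigma>\<^sup>2 * U y) \<partial>lborel)"
    using assms(2) by (intro integral_std_normal_rescale) auto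
  finally show ?thesis
    by (simp add: smoothed_slope_def)
qed

lemma prob_space_std_normal: "prob_space std_normal_distribution"
  by (rule prob_space_normal_density) simp

lemma integrable_std_normal_bounded:
  fixes f :: "real \<Rightarrow> real"
  assumes [measurable]: "f \<in> borel_measurable borel" and "\<And>x. \<bar>f x\<bar> \<le> B"
  shows "integrable std_normal_distribution f"
proof -
  interpret prob_space std_normal_distribution by (rule prob_space_std_normal)
  show ?thesis
    by (rule integrable_const_bound[where B=B]) (use assms in auto)
qed

lemma unit_valued_smoothed:
  assumes "unit_valued U"
  shows "unit_valued (smoothed \<sigma> U)"
proof -
  interpret prob_space std_normal_distribution by (rule prob_space_std_normal)
  have [measurable]: "U \<in> borel_measurable borel" and U: "0 \<le> U x" "U x \<le> 1" for x
    using assms by (auto simp: unit_valued_def)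
  have "smoothed \<sigma> U \<in> borel_measurable borel"
    unfolding smoothed_def[abs_def] by measurable
  moreover have "0 \<le> smoothed \<sigma> U x" for x
    unfolding smoothed_def using U by (intro Bochner_Integration.integral_nonneg) auto
  moreover have "smoothed \<sigma> U x \<le> 1" for x
    unfolding smoothed_def using U
    by (intro integral_le_const AE_I2 integrable_std_normal_bounded[where B=1]) (auto simp: abs_of_nonneg)
  ultimately show ?thesis
    by (auto simp: unit_valued_def)
qed

text \<open>
  The sum of independent centred Gaussians of variances \<open>\<sigma>\<^sup>2\<close> and \<open>\<eta>\<^sup>2\<close> is Gaussian of variance
  \<open>\<sigma>\<^sup>2 + \<eta>\<^sup>2\<close>. Replacing \<open>U\<close> by its smoothing therefore only widens every Gaussian
  average of \<open>U\<close>. The computation is done with nonnegative integrals, where the integrals may be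
  exchanged freely.
\<close>
lemma smoothed_smoothed:
  assumes U: "unit_valued U" and [arith]: "\<sigma> > 0" "\<eta> > 0"
  shows "smoothed \<sigma> (smoothed \<eta> U) x = smoothed (sqrt (\<sigma>\<^sup>2 + \<eta>\<^sup>2)) U x"
proof -
  have nn: "ennreal (smoothed \<tau> V x) = (\<integral>\<^sup>+z. ennreal (normal_density 0 \<tau> z) * ennreal (V (x + z)) \<partial>lborel)"
    if V: "unit_valued V" and \<tau>: "\<tau> > 0" for \<tau> V x
  proof -
    have [measurable]: "V \<in> borel_measurable borel" and Vb: "0 \<le> V x" "V x \<le> 1" for x
      using V by (auto simp: unit_valued_def)
    have "smoothed \<tau> V x = (\<integral>\<xi>. V (x + (0 + \<tau> * \<xi>)) \<partial>std_normal_distribution)"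
      by (simp add: smoothed_def)
    also have "\<dots> = (\<integral>z. normal_density 0 \<tau> z * V (x + z) \<partial>lborel)"
      using \<tau> by (intro integral_std_normal_rescale) auto
    also have "ennreal \<dots> = (\<integral>\<^sup>+z. ennreal (normal_density 0 \<tau> z * V (x + z)) \<partial>lborel)"
    proof (rule nn_integral_eq_integral[symmetric])
      show "integrable lborel (\<lambda>z. normal_density 0 \<tau> z * V (x + z))"
        using \<tau> Vb by (intro Bochner_Integration.integrable_bound[OF integrable_normal_density[of \<tau> 0]])
          (auto simp: abs_mult mult_left_le)
    qed (use Vb in auto)
    finally show ?thesis
      using Vb by (simp add: ennreal_mult)
  qed
  have [measurable]: "U \<in> borel_measurable borel" and Ub: "0 \<le> U x" "U x \<le> 1" for x
    using U by (auto simp: unit_valued_def)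
  have "ennreal (smoothed \<sigma> (smoothed \<eta> U) x) =
      (\<integral>\<^sup>+w. ennreal (normal_density 0 \<sigma> w) *
        (\<integral>\<^sup>+v. ennreal (normal_density 0 \<eta> v) * ennreal (U (x + w + v)) \<partial>lborel) \<partial>lborel)"
    using U by (simp add: nn unit_valued_smoothed)
  also have "\<dots> = (\<integral>\<^sup>+w. \<integral>\<^sup>+v. ennreal (normal_density 0 \<sigma> w) *
      (ennreal (normal_density 0 \<eta> v) * ennreal (U (x + w + v))) \<partial>lborel \<partial>lborel)"
    by (simp add: nn_integral_cmult)
  also have "\<dots> = (\<integral>\<^sup>+v. \<integral>\<^sup>+w. ennreal (normal_density 0 \<sigma> w) *
      (ennreal (normal_density 0 \<eta> v) * ennreal (U (x + w + v))) \<partial>lborel \<partial>lborel)"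
    by (rule lborel_pair.Fubini') simp
  also have "\<dots> = (\<integral>\<^sup>+v. \<integral>\<^sup>+z. ennreal (normal_density 0 \<sigma> (z - v)) *
      (ennreal (normal_density 0 \<eta> v) * ennreal (U (x + z))) \<partial>lborel \<partial>lborel)"
  proof (rule nn_integral_cong)
    fix v :: real
    show "(\<integral>\<^sup>+w. ennreal (normal_density 0 \<sigma> w) *
        (ennreal (normal_density 0 \<eta> v) * ennreal (U (x + w + v))) \<partial>lborel) =
      (\<integral>\<^sup>+z. ennreal (normal_density 0 \<sigma> (z - v)) *
        (ennreal (normal_density 0 \<eta> v) * ennreal (U (x + z))) \<partial>lborel)"
      by (subst nn_integral_real_affine[where c=1 and t="-v"]) (simp_all add: algebra_simps)
  qed
  also have "\<dots> = (\<integral>\<^sup>+z. \<integral>\<^sup>+v. ennreal (normal_density 0 \<sigma> (z - v)) *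
      (ennreal (normal_density 0 \<eta> v) * ennreal (U (x + z))) \<partial>lborel \<partial>lborel)"
    by (rule lborel_pair.Fubini') simp
  also have "\<dots> = (\<integral>\<^sup>+z. (\<integral>\<^sup>+v. ennreal (normal_density 0 \<sigma> (z - v) * normal_density 0 \<eta> v) \<partial>lborel) *
      ennreal (U (x + z)) \<partial>lborel)"
    by (simp add: nn_integral_multc[symmetric] ennreal_mult mult.assoc)
  also have "\<dots> = (\<integral>\<^sup>+z. ennreal (normal_density 0 (sqrt (\<sigma>\<^sup>2 + \<eta>\<^sup>2)) z) * ennreal (U (x + z)) \<partial>lborel)"
    by (simp add: conv_normal_density_zero_mean[unfolded fun_eq_iff, rule_format])
  also have "\<dots> = ennreal (smoothed (sqrt (\<sigma>\<^sup>2 + \<eta>\<^sup>2)) U x)"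
    using U by (intro nn[symmetric]) (auto intro: add_pos_pos)
  finally show ?thesis
    using unit_valued_smoothed[OF U] unit_valued_smoothed[OF unit_valued_smoothed[OF U]]
    by (subst (asm) ennreal_inj) (auto simp: unit_valued_def)
qed

text \<open>
  A bound uniform in the mean \<open>t\<close>, which serves as dominating function for derivatives in \<open>t\<close>; it
  follows from \<open>(y - x)\<^sup>2 \<le> 2 (y - t)\<^sup>2 + 2 (t - x)\<^sup>2\<close>, at the price of doubling the variance.
\<close>
lemma normal_density_le_shifted:
  assumes [arith]: "\<sigma> > 0" and "\<bar>t - x\<bar> \<le> 1"
  shows "normal_density t \<sigma> y \<le> sqrt 2 * exp (1 / (2 * \<sigma>\<^sup>2)) * normal_density x (sqrt 2 * \<sigma>) y"
proof -
  have "(y - x)\<^sup>2 \<le> 2 * (y - t)\<^sup>2 + 2 * (t - x)\<^sup>2"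
    using zero_le_power2[of "(y - t) - (t - x)"] by (simp add: power2_eq_square algebra_simps)
  moreover have "(t - x)\<^sup>2 \<le> 1"
    using assms(2) by (simp add: abs_square_le_1)
  ultimately have "- ((y - t)\<^sup>2) / (2 * \<sigma>\<^sup>2) \<le> (1 - (y - x)\<^sup>2 / 2) / (2 * \<sigma>\<^sup>2)"
    by (intro divide_right_mono) auto
  also have "\<dots> = 1 / (2 * \<sigma>\<^sup>2) + - ((y - x)\<^sup>2) / (2 * (sqrt 2 * \<sigma>)\<^sup>2)"
    by (simp add: power_mult_distrib field_simps)
  finally have "exp (- ((y - t)\<^sup>2) / (2 * \<sigma>\<^sup>2)) \<le>
      exp (1 / (2 * \<sigma>\<^sup>2)) * exp (- ((y - x)\<^sup>2) / (2 * (sqrt 2 * \<sigma>)\<^sup>2))"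
    by (simp flip: exp_add)
  then have "1 / sqrt (2 * pi * \<sigma>\<^sup>2) * exp (- ((y - t)\<^sup>2) / (2 * \<sigma>\<^sup>2)) \<le> 1 / sqrt (2 * pi * \<sigma>\<^sup>2) *
      (exp (1 / (2 * \<sigma>\<^sup>2)) * exp (- ((y - x)\<^sup>2) / (2 * (sqrt 2 * \<sigma>)\<^sup>2)))"
    by (rule mult_left_mono) simp
  moreover have eq: "1 / sqrt (2 * pi * \<sigma>\<^sup>2) = sqrt 2 * (1 / sqrt (2 * pi * (sqrt 2 * \<sigma>)\<^sup>2))"
  proof -
    have "sqrt (2 * pi * (sqrt 2 * \<sigma>)\<^sup>2) = sqrt 2 * sqrt (2 * pi * \<sigma>\<^sup>2)"
      unfolding real_sqrt_mult[symmetric] by (simp add: power_mult_distrib)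
    then show ?thesis by simp
  qed
  moreover have "1 / sqrt (2 * pi * \<sigma>\<^sup>2) * (exp (1 / (2 * \<sigma>\<^sup>2)) * exp (- ((y - x)\<^sup>2) / (2 * (sqrt 2 * \<sigma>)\<^sup>2))) =
      sqrt 2 * exp (1 / (2 * \<sigma>\<^sup>2)) * normal_density x (sqrt 2 * \<sigma>) y"
    unfolding eq normal_density_def by (simp only: mult_ac)
  ultimately show ?thesis
    unfolding normal_density_def by simp
qed

text \<open>
  A bound uniform in the width \<open>\<sigma>\<close>, the dominating function for limits in \<open>\<sigma>\<close>.
\<close>
lemma normal_density_le_wider:
  assumes "0 < a" "a \<le> \<sigma>" "\<sigma> \<le> b"
  shows "normal_density x \<sigma> y \<le> b / a * normal_density x b y"
proof -
  have "1 / sqrt (2 * pi * \<sigma>\<^sup>2) \<le> 1 / (sqrt (2 * pi) * a)"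
    using assms by (simp add: real_sqrt_mult frac_le)
  moreover have "- ((y - x)\<^sup>2) / (2 * \<sigma>\<^sup>2) \<le> - ((y - x)\<^sup>2) / (2 * b\<^sup>2)"
    using assms by (auto intro!: divide_left_mono power_mono)
  ultimately have "normal_density x \<sigma> y \<le> 1 / (sqrt (2 * pi) * a) * exp (- ((y - x)\<^sup>2) / (2 * b\<^sup>2))"
    using assms unfolding normal_density_def by (intro mult_mono) auto
  also have "\<dots> = b / a * normal_density x b y"
    using assms by (simp add: normal_density_def real_sqrt_mult)
  finally show ?thesis .
qed

text \<open>
  The inequality \<open>(y - x)\<^sup>2 \<le> 2 x\<^sup>2 + 2 y\<^sup>2\<close> separates \<open>x\<close> from \<open>y\<close>. What is left after the factor
  \<open>exp (- x\<^sup>2 / \<sigma>\<^sup>2)\<close> is a fixed centred Gaussian, independent of \<open>x\<close> and \<open>\<sigma>\<close>.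
\<close>
lemma normal_density_ge_centered:
  assumes "0 < a" "a \<le> \<sigma>" "\<sigma> \<le> b"
  shows "exp (- x\<^sup>2 / \<sigma>\<^sup>2) * (a / (sqrt 2 * b) * normal_density 0 (a / sqrt 2) y) \<le> normal_density x \<sigma> y"
proof -
  have "(y - x)\<^sup>2 \<le> 2 * x\<^sup>2 + 2 * y\<^sup>2"
    using zero_le_power2[of "y + x"] by (simp add: power2_eq_square algebra_simps)
  then have "- ((2 * x\<^sup>2 + 2 * y\<^sup>2) / (2 * \<sigma>\<^sup>2)) \<le> - ((y - x)\<^sup>2 / (2 * \<sigma>\<^sup>2))"
    by (intro le_imp_neg_le divide_right_mono) auto
  then have "- x\<^sup>2 / \<sigma>\<^sup>2 - y\<^sup>2 / \<sigma>\<^sup>2 \<le> - (y - x)\<^sup>2 / (2 * \<sigma>\<^sup>2)"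
    using assms by (simp add: add_divide_distrib)
  moreover have "y\<^sup>2 / \<sigma>\<^sup>2 \<le> y\<^sup>2 / a\<^sup>2"
    using assms by (intro divide_left_mono power_mono) auto
  ultimately have "exp (- x\<^sup>2 / \<sigma>\<^sup>2) * exp (- y\<^sup>2 / a\<^sup>2) \<le> exp (- (y - x)\<^sup>2 / (2 * \<sigma>\<^sup>2))"
    unfolding exp_add[symmetric] exp_le_cancel_iff by simp
  moreover have "1 / (sqrt (2 * pi) * b) \<le> 1 / sqrt (2 * pi * \<sigma>\<^sup>2)"
    using assms by (simp add: real_sqrt_mult frac_le)
  ultimately have "1 / (sqrt (2 * pi) * b) * (exp (- x\<^sup>2 / \<sigma>\<^sup>2) * exp (- y\<^sup>2 / a\<^sup>2)) \<le> normal_density x \<sigma> y"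
    using assms unfolding normal_density_def by (intro mult_mono) auto
  moreover have "a / (sqrt 2 * b) * normal_density 0 (a / sqrt 2) y = 1 / (sqrt (2 * pi) * b) * exp (- y\<^sup>2 / a\<^sup>2)"
    using assms by (simp add: normal_density_def real_sqrt_mult power_divide real_sqrt_divide)
  ultimately show ?thesis
    by (simp add: mult_ac)
qed

text \<open>
  The derivative falls on the density, and the densities with mean within distance 1 of \<open>x\<close> have a common
  integrable bound.
\<close>
lemma DERIV_smoothed:
  assumes U: "unit_valued U" and [arith]: "\<sigma> > 0"
  shows "(smoothed \<sigma> U has_real_derivative smoothed_slope \<sigma> U x) (at x)"
proof -
  have [measurable]: "U \<in> borel_measurable borel" and Ub: "0 \<le> U x" "U x \<le> 1" for x
    using U by (auto simp: unit_valued_def)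
  have "((\<lambda>t. \<integral>y. normal_density t \<sigma> y * U y \<partial>lborel) has_real_derivative
      (\<integral>y. normal_density x \<sigma> y * ((y - x) / \<sigma>\<^sup>2 * U y) \<partial>lborel)) (at x)"
  proof (rule has_real_derivative_integral_dominated[where a="x - 1" and b="x + 1"
        and f'="\<lambda>t y. normal_density t \<sigma> y * ((y - t) / \<sigma>\<^sup>2 * U y)"
        and g="\<lambda>y. sqrt 2 * exp (1 / (2 * \<sigma>\<^sup>2)) / \<sigma>\<^sup>2 *
          (normal_density x (sqrt 2 * \<sigma>) y * \<bar>y - x\<bar> ^ 1 + normal_density x (sqrt 2 * \<sigma>) y)"])
    fix t y :: real
    assume "t \<in> {x - 1<..<x + 1}"
    then have t: "\<bar>t - x\<bar> \<le> 1" by (auto simp: abs_le_iff)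
    have "((\<lambda>t. c * exp (- (y - t)\<^sup>2 / (2 * \<sigma>\<^sup>2)) * U y) has_real_derivative
        c * exp (- (y - t)\<^sup>2 / (2 * \<sigma>\<^sup>2)) * ((y - t) / \<sigma>\<^sup>2 * U y)) (at t)" for c
      by (auto intro!: derivative_eq_intros simp: field_simps)
    then show "((\<lambda>t. normal_density t \<sigma> y * U y) has_real_derivative
        normal_density t \<sigma> y * ((y - t) / \<sigma>\<^sup>2 * U y)) (at t)"
      unfolding normal_density_def .
    have "\<bar>y - t\<bar> / \<sigma>\<^sup>2 * U y \<le> (\<bar>y - x\<bar> + 1) / \<sigma>\<^sup>2 * 1"
      using t Ub by (intro mult_mono divide_right_mono) auto
    then have "normal_density t \<sigma> y * (\<bar>y - t\<bar> / \<sigma>\<^sup>2 * U y) \<le>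
        (sqrt 2 * exp (1 / (2 * \<sigma>\<^sup>2)) * normal_density x (sqrt 2 * \<sigma>) y) * ((\<bar>y - x\<bar> + 1) / \<sigma>\<^sup>2)"
      using t Ub by (intro mult_mono normal_density_le_shifted) auto
    also have "\<dots> = sqrt 2 * exp (1 / (2 * \<sigma>\<^sup>2)) / \<sigma>\<^sup>2 *
          (normal_density x (sqrt 2 * \<sigma>) y * \<bar>y - x\<bar> ^ 1 + normal_density x (sqrt 2 * \<sigma>) y)"
      by (simp add: field_simps)
    finally show "\<bar>normal_density t \<sigma> y * ((y - t) / \<sigma>\<^sup>2 * U y)\<bar> \<le>
        sqrt 2 * exp (1 / (2 * \<sigma>\<^sup>2)) / \<sigma>\<^sup>2 *
          (normal_density x (sqrt 2 * \<sigma>) y * \<bar>y - x\<bar> ^ 1 + normal_density x (sqrt 2 * \<sigma>) y)"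
      using Ub by (simp add: abs_mult)
    show "integrable lborel (\<lambda>y. normal_density t \<sigma> y * U y)"
      using Ub by (intro Bochner_Integration.integrable_bound[OF integrable_normal_density[of \<sigma> t]])
        (auto simp: abs_mult mult_left_le)
  next
    show "integrable lborel (\<lambda>y. sqrt 2 * exp (1 / (2 * \<sigma>\<^sup>2)) / \<sigma>\<^sup>2 *
          (normal_density x (sqrt 2 * \<sigma>) y * \<bar>y - x\<bar> ^ 1 + normal_density x (sqrt 2 * \<sigma>) y))"
      by (intro integrable_mult_right Bochner_Integration.integrable_add
          integrable_normal_moment_abs integrable_normal_density) auto
  qed auto
  moreover have "smoothed \<sigma> U = (\<lambda>t. \<integral>y. normal_density t \<sigma> y * U y \<partial>lborel)"
    by (simp add: fun_eq_iff smoothed_density[OF U])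
  ultimately show ?thesis
    by (simp add: smoothed_slope_density[OF U])
qed

text \<open>
  For widths between \<open>s / 2\<close> and \<open>2 * s\<close> the densities are at most 4 times the density of width
  \<open>2 * s\<close>, all of whose moments are finite.
\<close>
lemma isCont_smoothed_width:
  assumes U: "unit_valued U" and s: "s > 0"
  shows "isCont (\<lambda>\<sigma>. smoothed \<sigma> U x) s" and "isCont (\<lambda>\<sigma>. smoothed_slope \<sigma> U x) s"
proof -
  have [measurable]: "U \<in> borel_measurable borel" and Ub: "0 \<le> U x" "U x \<le> 1" for x
    using U by (auto simp: unit_valued_def)
  define S where "S = {s / 2<..<2 * s}"
  have at: "at s within S = at s"
    using s unfolding S_def by (intro at_within_open) auto
  have in_S: "\<forall>\<^sub>F \<sigma> in at s. 0 < \<sigma>"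
    using order_tendstoD(1)[OF tendsto_ident_at s] .
  have dens: "normal_density x \<sigma> y \<le> 4 * normal_density x (2 * s) y" if "\<sigma> \<in> S" for \<sigma> y
    using normal_density_le_wider[of "s / 2" \<sigma> "2 * s" x y] that s by (auto simp: S_def)
  have sq: "(s / 2)\<^sup>2 \<le> \<sigma>\<^sup>2" if "\<sigma> \<in> S" for \<sigma>
    using that s unfolding S_def by (intro power_mono) auto
  have "((\<lambda>\<sigma>. \<integral>y. normal_density x \<sigma> y * U y \<partial>lborel) \<longlongrightarrow>
      (\<integral>y. normal_density x s y * U y \<partial>lborel)) (at s within S)"
  proof (rule tendsto_integral_dominated_within[where g="\<lambda>y. 4 * normal_density x (2 * s) y"])
    show "\<bar>normal_density x \<sigma> y * U y\<bar> \<le> 4 * normal_density x (2 * s) y" if "\<sigma> \<in> S" for \<sigma> y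
    proof -
      have "normal_density x \<sigma> y * U y \<le> 4 * normal_density x (2 * s) y * 1"
        using dens[OF that] Ub by (intro mult_mono) auto
      then show ?thesis using Ub by (simp add: abs_mult)
    qed
    show "((\<lambda>\<sigma>. normal_density x \<sigma> y * U y) \<longlongrightarrow> normal_density x s y * U y) (at s within S)" for y
      unfolding normal_density_def using s by (intro tendsto_intros) auto
  qed (use s in auto)
  then have "((\<lambda>\<sigma>. smoothed \<sigma> U x) \<longlongrightarrow> smoothed s U x) (at s)"
    unfolding at smoothed_density[OF U s]
    by (rule Lim_transform_eventually) (use in_S in eventually_elim, simp add: smoothed_density[OF U])
  then show "isCont (\<lambda>\<sigma>. smoothed \<sigma> U x) s"
    by (simp add: isCont_def)
  have "((\<lambda>\<sigma>. \<integral>y. normal_density x \<sigma> y * ((y - x) / \<sigma>\<^sup>2 * U y) \<partial>lborel) \<longlongrightarrow>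
      (\<integral>y. normal_density x s y * ((y - x) / s\<^sup>2 * U y) \<partial>lborel)) (at s within S)"
  proof (rule tendsto_integral_dominated_within
      [where g="\<lambda>y. 4 / (s / 2)\<^sup>2 * (normal_density x (2 * s) y * \<bar>y - x\<bar> ^ 1)"])
    show "\<bar>normal_density x \<sigma> y * ((y - x) / \<sigma>\<^sup>2 * U y)\<bar> \<le>
        4 / (s / 2)\<^sup>2 * (normal_density x (2 * s) y * \<bar>y - x\<bar> ^ 1)" if "\<sigma> \<in> S" for \<sigma> y
    proof -
      have "\<bar>y - x\<bar> / \<sigma>\<^sup>2 \<le> \<bar>y - x\<bar> / (s / 2)\<^sup>2"
        using sq[OF that] s by (intro divide_left_mono) (auto intro!: mult_pos_pos simp: that S_def)
      then have "normal_density x \<sigma> y * (\<bar>y - x\<bar> / \<sigma>\<^sup>2 * U y) \<le>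
          (4 * normal_density x (2 * s) y) * (\<bar>y - x\<bar> / (s / 2)\<^sup>2 * 1)"
        using dens[OF that] Ub by (intro mult_mono) auto
      then show ?thesis using Ub by (simp add: abs_mult mult_ac)
    qed
    show "((\<lambda>\<sigma>. normal_density x \<sigma> y * ((y - x) / \<sigma>\<^sup>2 * U y)) \<longlongrightarrow>
        normal_density x s y * ((y - x) / s\<^sup>2 * U y)) (at s within S)" for y
      unfolding normal_density_def using s by (intro tendsto_intros) auto
    show "integrable lborel (\<lambda>y. 4 / (s / 2)\<^sup>2 * (normal_density x (2 * s) y * \<bar>y - x\<bar> ^ 1))"
      using s by (intro integrable_mult_right integrable_normal_moment_abs) auto
  qed (use s in auto)
  then have "((\<lambda>\<sigma>. smoothed_slope \<sigma> U x) \<longlongrightarrow> smoothed_slope s U x) (at s)"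
    unfolding at smoothed_slope_density[OF U s]
    by (rule Lim_transform_eventually) (use in_S in eventually_elim, simp add: smoothed_slope_density[OF U])
  then show "isCont (\<lambda>\<sigma>. smoothed_slope \<sigma> U x) s"
    by (simp add: isCont_def)
qed

text \<open>
  Since \<open>0 \<le> U \<le> 1\<close>, the numerator is at most the mean of \<open>\<bar>\<xi>\<bar>\<close>, which is \<open>sqrt (2 / pi)\<close>.
\<close>
lemma abs_smoothed_slope_le:
  assumes U: "unit_valued U" and s: "\<sigma> > 0"
  shows "\<bar>smoothed_slope \<sigma> U x\<bar> \<le> 1 / \<sigma>"
proof -
  have [measurable]: "U \<in> borel_measurable borel" and Ub: "0 \<le> U x" "U x \<le> 1" for x
    using U by (auto simp: unit_valued_def)
  have int: "integrable std_normal_distribution (\<lambda>\<xi>::real. \<bar>\<xi>\<bar>)"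
    using integrable_std_normal_distribution_moment[of 1] by simp
  have "\<bar>\<integral>\<xi>. \<xi> * U (x + \<sigma> * \<xi>) \<partial>std_normal_distribution\<bar> \<le> (\<integral>\<xi>. \<bar>\<xi> * U (x + \<sigma> * \<xi>)\<bar> \<partial>std_normal_distribution)"
    by (rule integral_abs_bound)
  also have "\<dots> \<le> (\<integral>\<xi>. \<bar>\<xi>\<bar> \<partial>std_normal_distribution)"
    using Ub by (intro integral_mono_AE' int AE_I2) (auto simp: abs_mult mult_left_le)
  also have "\<dots> = sqrt (2 / pi)"
    using std_normal_distribution_odd_moments_abs[of 0] by simp
  also have "\<dots> \<le> 1"
    using pi_ge_two by simp
  finally show ?thesis
    using s by (simp add: smoothed_slope_def abs_divide divide_right_mono)
qed

lemma borel_measurable_smoothed_slope: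
  assumes U: "unit_valued U"
  shows "smoothed_slope \<sigma> U \<in> borel_measurable borel"
proof -
  have [measurable]: "U \<in> borel_measurable borel"
    using U by (auto simp: unit_valued_def)
  interpret prob_space std_normal_distribution by (rule prob_space_std_normal)
  show ?thesis
    unfolding smoothed_slope_def[abs_def] by measurable
qed

lemma assumption1_unit_valued: "assumption1 U \<Longrightarrow> unit_valued U"
  by (auto simp: assumption1_def unit_valued_def)

text \<open>
  A vanishing Gaussian average of the nonnegative function \<open>U\<close> forces \<open>U\<close> to vanish almost
  everywhere, against the condition that \<open>\<xi> U(\<xi>)\<close> has nonzero mean.
\<close>
lemma smoothed_pos:
  assumes A: "assumption1 U" and s: "\<sigma> > 0"
  shows "0 < smoothed \<sigma> U x"
proof (rule ccontr)
  have U: "unit_valued U" using A by (rule assumption1_unit_valued)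
  have [measurable]: "U \<in> borel_measurable borel" and Ub: "0 \<le> U x" "U x \<le> 1" for x
    using U by (auto simp: unit_valued_def)
  assume "\<not> 0 < smoothed \<sigma> U x"
  then have "smoothed \<sigma> U x = 0"
    using unit_valued_smoothed[OF U, of \<sigma>] by (auto simp: unit_valued_def intro: antisym)
  then have "(\<integral>y. normal_density x \<sigma> y * U y \<partial>lborel) = 0"
    using s U by (simp add: smoothed_density)
  moreover have "integrable lborel (\<lambda>y. normal_density x \<sigma> y * U y)"
    using Ub s by (intro Bochner_Integration.integrable_bound[OF integrable_normal_density[of \<sigma> x]])
        (auto simp: abs_mult mult_left_le)
  ultimately have "AE y in lborel. normal_density x \<sigma> y * U y = 0"
    using Ub by (subst (asm) integral_nonneg_eq_0_iff_AE) auto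
  then have "AE y in lborel. U y = 0"
    using normal_density_pos[OF s] by (auto simp: less_le)
  then have "(\<integral>\<xi>. \<xi> * U \<xi> \<partial>std_normal_distribution) = (\<integral>\<xi>. 0 \<partial>std_normal_distribution)"
    by (intro integral_cong_AE) (auto simp: AE_density)
  with A show False
    by (auto simp: assumption1_def)
qed

text \<open>
  The only way the logarithm or the quotient by \<open>smoothed \<sigma> U x\<close> could spoil integrability is
  through small values far out. This bound excludes it: the decay in \<open>x\<close> is at most Gaussian,
  uniformly over widths in a compact range.
\<close>
lemma smoothed_gaussian_lower_bound:
  assumes A: "assumption1 U" and a: "0 < a"
  shows "\<exists>m>0. \<forall>\<sigma>\<in>{a..b}. \<forall>x. m * exp (- x\<^sup>2 / \<sigma>\<^sup>2) \<le> smoothed \<sigma> U x"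
proof (cases "a \<le> b")
  case True
  have U: "unit_valued U" using A by (rule assumption1_unit_valued)
  have [measurable]: "U \<in> borel_measurable borel" and Ub: "0 \<le> U x" "U x \<le> 1" for x
    using U by (auto simp: unit_valued_def)
  have int: "integrable lborel (\<lambda>y. normal_density x \<sigma> y * U y)" if "\<sigma> > 0" for x \<sigma>
    using Ub that by (intro Bochner_Integration.integrable_bound[OF integrable_normal_density[of \<sigma> x]])
        (auto simp: abs_mult mult_left_le)
  define m where "m = a / (sqrt 2 * b) * smoothed (a / sqrt 2) U 0"
  have "m > 0"
    unfolding m_def using a True by (intro mult_pos_pos smoothed_pos A) auto
  moreover have "m * exp (- x\<^sup>2 / \<sigma>\<^sup>2) \<le> smoothed \<sigma> U x" if \<sigma>: "\<sigma> \<in> {a..b}" for \<sigma> x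
  proof -
    have "m * exp (- x\<^sup>2 / \<sigma>\<^sup>2) =
        (\<integral>y. exp (- x\<^sup>2 / \<sigma>\<^sup>2) * (a / (sqrt 2 * b)) * (normal_density 0 (a / sqrt 2) y * U y) \<partial>lborel)"
      using a by (simp add: m_def smoothed_density[OF U])
    also have "\<dots> \<le> (\<integral>y. normal_density x \<sigma> y * U y \<partial>lborel)"
    proof (rule integral_mono)
      fix y
      show "exp (- x\<^sup>2 / \<sigma>\<^sup>2) * (a / (sqrt 2 * b)) * (normal_density 0 (a / sqrt 2) y * U y) \<le> normal_density x \<sigma> y * U y"
        using mult_right_mono[OF normal_density_ge_centered[of a \<sigma> b x y] Ub(1)[of y]] \<sigma> a
        by (simp add: mult.assoc)
    qed (use a \<sigma> in \<open>auto intro!: int integrable_mult_right\<close>)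
    finally show ?thesis
      using a \<sigma> by (simp add: smoothed_density[OF U])
  qed
  ultimately show ?thesis by blast
qed (auto intro!: exI[of _ 1])

section \<open>The logarithm of a smoothed function and its slope\<close>

text \<open>
  Both sides are derivatives of the same function, by the composition law for smoothings.
\<close>
lemma smoothed_slope_smoothed:
  assumes U: "unit_valued U" and "\<sigma> > 0" "\<eta> > 0"
  shows "smoothed_slope \<sigma> (smoothed \<eta> U) x = smoothed_slope (sqrt (\<sigma>\<^sup>2 + \<eta>\<^sup>2)) U x"
proof -
  have "smoothed \<sigma> (smoothed \<eta> U) = smoothed (sqrt (\<sigma>\<^sup>2 + \<eta>\<^sup>2)) U"
    using assms by (simp add: fun_eq_iff smoothed_smoothed)
  moreover have "sqrt (\<sigma>\<^sup>2 + \<eta>\<^sup>2) > 0"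
    using assms by (simp add: add_pos_pos)
  ultimately show ?thesis
    using DERIV_smoothed[OF unit_valued_smoothed[OF U, of \<eta>] \<open>\<sigma> > 0\<close>, of x]
      DERIV_smoothed[OF U, of "sqrt (\<sigma>\<^sup>2 + \<eta>\<^sup>2)" x]
    by (auto intro: DERIV_unique)
qed

lemma L_eq: "L U q x = ln (smoothed (sqrt (1 - q)) U x)"
  by (simp add: L_def smoothed_def)

lemma F_eq:
  assumes A: "assumption1 U" and q: "q < 1"
  shows "F U q x = smoothed_slope (sqrt (1 - q)) U x / smoothed (sqrt (1 - q)) U x"
proof -
  have "(smoothed (sqrt (1 - q)) U has_real_derivative smoothed_slope (sqrt (1 - q)) U x) (at x)"
    using q by (intro DERIV_smoothed assumption1_unit_valued[OF A]) simp
  then have "((\<lambda>x. ln (smoothed (sqrt (1 - q)) U x)) has_real_derivative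
      smoothed_slope (sqrt (1 - q)) U x / smoothed (sqrt (1 - q)) U x) (at x)"
    using smoothed_pos[OF A, of "sqrt (1 - q)" x] q
    by (auto intro!: derivative_eq_intros)
  then show ?thesis
    unfolding F_def L_eq[abs_def] by (rule DERIV_imp_deriv)
qed

lemma tendsto_smoothing_width:
  "((\<lambda>\<eta>. sqrt (r + \<eta>\<^sup>2)) \<longlongrightarrow> sqrt r) (at_right 0)"
  by (auto intro!: tendsto_eq_intros)

text \<open>
  The mean of \<open>\<xi>\<close> times the smoothed function is a slope of \<open>U\<close> at width \<open>sqrt (1 + \<eta>\<^sup>2)\<close>, which
  depends continuously on \<open>\<eta>\<close> and is nonzero at \<open>\<eta> = 0\<close>.
\<close>
lemma eventually_assumption1_smoothed:
  assumes A: "assumption1 U"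
  shows "\<forall>\<^sub>F \<eta> in at_right 0. assumption1 (smoothed \<eta> U)"
proof -
  have U: "unit_valued U" using A by (rule assumption1_unit_valued)
  have "((\<lambda>\<eta>. smoothed_slope (sqrt (1 + \<eta>\<^sup>2)) U 0) \<longlongrightarrow> smoothed_slope (sqrt 1) U 0) (at_right 0)"
    using U by (intro isCont_tendsto_compose[OF isCont_smoothed_width(2)] tendsto_smoothing_width) auto
  moreover have "smoothed_slope (sqrt 1) U 0 \<noteq> 0"
    using A by (simp add: smoothed_slope_def assumption1_def)
  ultimately have "\<forall>\<^sub>F \<eta> in at_right 0. smoothed_slope (sqrt (1 + \<eta>\<^sup>2)) U 0 \<noteq> 0"
    by (rule tendsto_imp_eventually_ne)
  moreover have "\<forall>\<^sub>F \<eta> in at_right 0. (0::real) < \<eta>"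
    by (rule eventually_at_right_less)
  ultimately show ?thesis
  proof eventually_elim
    case (elim \<eta>)
    then have "smoothed_slope 1 (smoothed \<eta> U) 0 \<noteq> 0"
      using U by (simp add: smoothed_slope_smoothed)
    then show ?case
      using unit_valued_smoothed[OF U, of \<eta>]
      by (auto simp: assumption1_def unit_valued_def smoothed_slope_def)
  qed
qed

lemma L_smoothed:
  assumes "unit_valued U" "q < 1" "\<eta> > 0"
  shows "L (smoothed \<eta> U) q x = ln (smoothed (sqrt (1 - q + \<eta>\<^sup>2)) U x)"
  using assms by (simp add: L_eq smoothed_smoothed)

lemma F_smoothed:
  assumes "assumption1 U" "assumption1 (smoothed \<eta> U)" "q < 1" "\<eta> > 0"
  shows "F (smoothed \<eta> U) q x =
    smoothed_slope (sqrt (1 - q + \<eta>\<^sup>2)) U x / smoothed (sqrt (1 - q + \<eta>\<^sup>2)) U x"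
  using assms assumption1_unit_valued[OF assms(1)]
  by (simp add: F_eq smoothed_smoothed smoothed_slope_smoothed)

lemma integrable_exp_quarter_square: "integrable std_normal_distribution (\<lambda>z. exp (z\<^sup>2 / 4))"
proof -
  have "std_normal_density z * exp (z\<^sup>2 / 4) = sqrt 2 * normal_density 0 (sqrt 2) z" for z :: real
    by (simp add: normal_density_def real_sqrt_mult field_simps flip: exp_add)
  then show ?thesis
    by (subst integrable_density) (auto intro!: integrable_mult_right)
qed

text \<open>
  As \<open>q \<le> 1 / 25\<close> and \<open>\<sigma>\<^sup>2 \<ge> 1 / 2\<close>, the lower bound decays no faster than \<open>exp (- z\<^sup>2 / 8)\<close> in terms
  of \<open>z\<close>. Hence the logarithm grows at most quadratically and the squared logarithmic slope at most
  like \<open>exp (z\<^sup>2 / 4)\<close>; both are integrable against the density proportional to \<open>exp (- z\<^sup>2 / 2)\<close>.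
\<close>
lemma log_slope_bounds:
  assumes U: "unit_valued U" and m: "0 < m" and \<sigma>: "1 / 2 \<le> \<sigma>\<^sup>2" "0 < \<sigma>" and q: "0 \<le> q" "q \<le> 1 / 25"
    and lower: "m * exp (- (sqrt q * z)\<^sup>2 / \<sigma>\<^sup>2) \<le> smoothed \<sigma> U (sqrt q * z)"
  shows "\<bar>ln (smoothed \<sigma> U (sqrt q * z))\<bar> \<le> \<bar>ln m\<bar> + z\<^sup>2"
    and "(smoothed_slope \<sigma> U (sqrt q * z) / smoothed \<sigma> U (sqrt q * z))\<^sup>2 \<le> 2 / m\<^sup>2 * exp (z\<^sup>2 / 4)"
proof -
  let ?s = "smoothed \<sigma> U (sqrt q * z)"
  have "q * z\<^sup>2 \<le> 1 / 25 * z\<^sup>2"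
    using q by (intro mult_right_mono) auto
  then have "(sqrt q * z)\<^sup>2 / \<sigma>\<^sup>2 \<le> (1 / 25 * z\<^sup>2) / (1 / 2)"
    using q \<sigma> by (intro frac_le) (auto simp: power_mult_distrib)
  also have "\<dots> \<le> z\<^sup>2 / 8"
    by (simp add: field_simps)
  finally have "(sqrt q * z)\<^sup>2 / \<sigma>\<^sup>2 \<le> z\<^sup>2 / 8" .
  then have e: "- (z\<^sup>2 / 8) \<le> - (sqrt q * z)\<^sup>2 / \<sigma>\<^sup>2"
    unfolding minus_divide_left[symmetric] by linarith
  have "m * exp (- (z\<^sup>2 / 8)) \<le> m * exp (- (sqrt q * z)\<^sup>2 / \<sigma>\<^sup>2)"
    using m e by (intro mult_left_mono) auto
  with lower have s: "m * exp (- (z\<^sup>2 / 8)) \<le> ?s"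
    by linarith
  have s1: "?s \<le> 1"
    using unit_valued_smoothed[OF U, of \<sigma>] by (simp add: unit_valued_def)
  have s0: "0 < ?s"
    using mult_pos_pos[OF m exp_gt_zero[of "- (z\<^sup>2 / 8)"]] s by linarith
  have "ln (m * exp (- (z\<^sup>2 / 8))) \<le> ln ?s"
    using s m s0 by (intro ln_mono) auto
  then have "ln m - z\<^sup>2 / 8 \<le> ln ?s"
    using m by (simp add: ln_mult)
  moreover have "ln ?s \<le> 0"
    using s1 s0 by simp
  ultimately show "\<bar>ln ?s\<bar> \<le> \<bar>ln m\<bar> + z\<^sup>2"
    using zero_le_power2[of z] by linarith
  have "(smoothed_slope \<sigma> U (sqrt q * z))\<^sup>2 \<le> (1 / \<sigma>)\<^sup>2"
    using abs_smoothed_slope_le[OF U, of \<sigma> "sqrt q * z"] \<sigma> by (intro abs_le_square_iff[THEN iffD1]) auto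
  also have "\<dots> \<le> 2"
    using \<sigma> by (simp add: power_divide divide_le_eq)
  finally have "(smoothed_slope \<sigma> U (sqrt q * z))\<^sup>2 / ?s\<^sup>2 \<le> 2 / (m * exp (- (z\<^sup>2 / 8)))\<^sup>2"
    using s m by (intro frac_le power_mono) auto
  also have "\<dots> = 2 / m\<^sup>2 * exp (z\<^sup>2 / 4)"
    by (simp add: power_mult_distrib exp_minus field_simps flip: exp_double)
  finally show "(smoothed_slope \<sigma> U (sqrt q * z) / ?s)\<^sup>2 \<le> 2 / m\<^sup>2 * exp (z\<^sup>2 / 4)"
    by (simp add: power_divide)
qed

definition mean_L :: "(real \<Rightarrow> real) \<Rightarrow> real \<Rightarrow> real" where
  "mean_L U q = (\<integral>z. L U q (sqrt q * z) \<partial>std_normal_distribution)"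

definition mean_F2 :: "(real \<Rightarrow> real) \<Rightarrow> real \<Rightarrow> real" where
  "mean_F2 U q = (\<integral>z. (F U q (sqrt q * z))\<^sup>2 \<partial>std_normal_distribution)"

lemma integrable_L:
  assumes A: "assumption1 U" and q: "0 \<le> q" "q \<le> 1 / 25"
  shows "integrable std_normal_distribution (\<lambda>z. L U q (sqrt q * z))"
proof -
  have U: "unit_valued U" using A by (rule assumption1_unit_valued)
  have [measurable]: "smoothed \<sigma> U \<in> borel_measurable borel" for \<sigma>
    using unit_valued_smoothed[OF U] by (simp add: unit_valued_def)
  have r: "1 / 2 \<le> sqrt (1 - q)" "sqrt (1 - q) \<le> 2"
    using q by (intro real_le_rsqrt real_le_lsqrt; simp add: power2_eq_square)+
  obtain m where m: "0 < m" "\<And>\<sigma> x. \<sigma> \<in> {1/2..2} \<Longrightarrow> m * exp (- x\<^sup>2 / \<sigma>\<^sup>2) \<le> smoothed \<sigma> U x"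
    using smoothed_gaussian_lower_bound[OF A, of "1/2" 2] by auto
  interpret prob_space std_normal_distribution by (rule prob_space_std_normal)
  show ?thesis
  proof (rule Bochner_Integration.integrable_bound)
    show "integrable std_normal_distribution (\<lambda>z. \<bar>ln m\<bar> + z\<^sup>2)"
      by (intro Bochner_Integration.integrable_add integrable_std_normal_distribution_moment) auto
    show "(\<lambda>z. L U q (sqrt q * z)) \<in> borel_measurable std_normal_distribution"
      by (simp add: L_eq)
    show "AE z in std_normal_distribution. norm (L U q (sqrt q * z)) \<le> norm (\<bar>ln m\<bar> + z\<^sup>2)"
    proof (rule AE_I2)
      fix z
      have "\<bar>ln (smoothed (sqrt (1 - q)) U (sqrt q * z))\<bar> \<le> \<bar>ln m\<bar> + z\<^sup>2"
        using r q by (intro log_slope_bounds(1)[OF U m(1) _ _ q m(2)]) auto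
      then show "norm (L U q (sqrt q * z)) \<le> norm (\<bar>ln m\<bar> + z\<^sup>2)"
        by (simp add: L_eq)
    qed
  qed
qed

text \<open>
  For the smoothed function the width \<open>sqrt (1 - q)\<close> is replaced by \<open>sqrt (1 - q + \<eta>\<^sup>2)\<close>. The
  integrands converge pointwise by continuity in the width, and the bounds above dominate them
  uniformly in \<open>\<eta>\<close>.
\<close>
lemma tendsto_mean_L_mean_F2:
  assumes A: "assumption1 U" and q: "0 \<le> q" "q \<le> 1 / 25"
  shows "((\<lambda>\<eta>. mean_L (smoothed \<eta> U) q) \<longlongrightarrow> mean_L U q) (at_right 0)"
    and "((\<lambda>\<eta>. mean_F2 (smoothed \<eta> U) q) \<longlongrightarrow> mean_F2 U q) (at_right 0)"
proof -
  have U: "unit_valued U" using A by (rule assumption1_unit_valued)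
  have [measurable]: "smoothed \<sigma> U \<in> borel_measurable borel" for \<sigma>
    using unit_valued_smoothed[OF U] by (simp add: unit_valued_def)
  note borel_measurable_smoothed_slope[OF U, measurable]
  interpret prob_space std_normal_distribution by (rule prob_space_std_normal)
  define w where "w \<eta> = sqrt (1 - q + \<eta>\<^sup>2)" for \<eta>
  have w0: "w 0 = sqrt (1 - q)" by (simp add: w_def)
  have at: "at 0 within {0<..<1} = at_right (0::real)"
    by (intro at_within_nhd[of _ "{..<1}"]) auto
  have w: "1 / 2 \<le> (w \<eta>)\<^sup>2" "1 / 2 \<le> w \<eta>" "w \<eta> \<le> 2" "0 < w \<eta>" if "\<eta> \<in> {0<..<1}" for \<eta>
  proof -
    have "\<eta>\<^sup>2 \<le> 1" using that by (simp add: power_le_one)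
    then have r: "1 / 2 \<le> 1 - q + \<eta>\<^sup>2" "1 - q + \<eta>\<^sup>2 \<le> 4"
      using q zero_le_power2[of \<eta>] by linarith+
    then show "1 / 2 \<le> (w \<eta>)\<^sup>2"
      by (simp add: w_def)
    show "1 / 2 \<le> w \<eta>"
      unfolding w_def using r by (intro real_le_rsqrt) (simp add: power2_eq_square)
    then show "0 < w \<eta>" by linarith
    show "w \<eta> \<le> 2"
      unfolding w_def using r by (intro real_le_lsqrt) auto
  qed
  have lim_w: "(w \<longlongrightarrow> w 0) (at_right 0)"
    unfolding w_def using tendsto_smoothing_width[of "1 - q"] by simp
  have w0_pos: "0 < w 0" using q by (simp add: w0)
  have lim_s: "((\<lambda>\<eta>. smoothed (w \<eta>) U x) \<longlongrightarrow> smoothed (w 0) U x) (at_right 0)" for x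
    by (rule isCont_tendsto_compose[OF isCont_smoothed_width(1)[OF U w0_pos] lim_w])
  have lim_d: "((\<lambda>\<eta>. smoothed_slope (w \<eta>) U x) \<longlongrightarrow> smoothed_slope (w 0) U x) (at_right 0)" for x
    by (rule isCont_tendsto_compose[OF isCont_smoothed_width(2)[OF U w0_pos] lim_w])
  have pos: "0 < smoothed (w 0) U x" for x
    using smoothed_pos[OF A w0_pos] .
  obtain m where m: "0 < m" "\<And>\<sigma> x. \<sigma> \<in> {1/2..2} \<Longrightarrow> m * exp (- x\<^sup>2 / \<sigma>\<^sup>2) \<le> smoothed \<sigma> U x"
    using smoothed_gaussian_lower_bound[OF A, of "1/2" 2] by auto
  have ev: "\<forall>\<^sub>F \<eta> in at_right 0. (0::real) < \<eta>"
    by (rule eventually_at_right_less)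
  have "((\<lambda>\<eta>. \<integral>z. ln (smoothed (w \<eta>) U (sqrt q * z)) \<partial>std_normal_distribution) \<longlongrightarrow>
      (\<integral>z. ln (smoothed (w 0) U (sqrt q * z)) \<partial>std_normal_distribution)) (at 0 within {0<..<1})"
  proof (rule tendsto_integral_dominated_within[where g="\<lambda>z. \<bar>ln m\<bar> + z\<^sup>2"])
    show "\<bar>ln (smoothed (w \<eta>) U (sqrt q * z))\<bar> \<le> \<bar>ln m\<bar> + z\<^sup>2" if "\<eta> \<in> {0<..<1}" for \<eta> z
      using w[OF that] m q by (intro log_slope_bounds(1)[OF U]) auto
    show "((\<lambda>\<eta>. ln (smoothed (w \<eta>) U (sqrt q * z))) \<longlongrightarrow> ln (smoothed (w 0) U (sqrt q * z))) (at 0 within {0<..<1})" for z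
      unfolding at by (rule tendsto_ln[OF lim_s]) (use pos[of "sqrt q * z"] in simp)
  qed (auto intro!: Bochner_Integration.integrable_add integrable_std_normal_distribution_moment)
  moreover have "\<forall>\<^sub>F \<eta> in at_right 0. (\<integral>z. ln (smoothed (w \<eta>) U (sqrt q * z)) \<partial>std_normal_distribution) =
      mean_L (smoothed \<eta> U) q"
    using ev q by (auto elim!: eventually_mono simp: mean_L_def w_def L_smoothed[OF U])
  ultimately show "((\<lambda>\<eta>. mean_L (smoothed \<eta> U) q) \<longlongrightarrow> mean_L U q) (at_right 0)"
    unfolding at mean_L_def[of U] L_eq w0 by (rule Lim_transform_eventually)
  have "((\<lambda>\<eta>. \<integral>z. (smoothed_slope (w \<eta>) U (sqrt q * z) / smoothed (w \<eta>) U (sqrt q * z))\<^sup>2 \<partial>std_normal_distribution) \<longlongrightarrow>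
      (\<integral>z. (smoothed_slope (w 0) U (sqrt q * z) / smoothed (w 0) U (sqrt q * z))\<^sup>2 \<partial>std_normal_distribution)) (at 0 within {0<..<1})"
  proof (rule tendsto_integral_dominated_within[where g="\<lambda>z. 2 / m\<^sup>2 * exp (z\<^sup>2 / 4)"])
    show "\<bar>(smoothed_slope (w \<eta>) U (sqrt q * z) / smoothed (w \<eta>) U (sqrt q * z))\<^sup>2\<bar> \<le> 2 / m\<^sup>2 * exp (z\<^sup>2 / 4)"
      if "\<eta> \<in> {0<..<1}" for \<eta> z
      unfolding abs_power2 using w[OF that] m q by (intro log_slope_bounds(2)[OF U]) auto
    show "((\<lambda>\<eta>. (smoothed_slope (w \<eta>) U (sqrt q * z) / smoothed (w \<eta>) U (sqrt q * z))\<^sup>2) \<longlongrightarrow>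
        (smoothed_slope (w 0) U (sqrt q * z) / smoothed (w 0) U (sqrt q * z))\<^sup>2) (at 0 within {0<..<1})" for z
      unfolding at by (intro tendsto_intros lim_s lim_d) (use pos[of "sqrt q * z"] in simp)
  qed (auto intro!: integrable_mult_right integrable_exp_quarter_square)
  moreover have "\<forall>\<^sub>F \<eta> in at_right 0.
      (\<integral>z. (smoothed_slope (w \<eta>) U (sqrt q * z) / smoothed (w \<eta>) U (sqrt q * z))\<^sup>2 \<partial>std_normal_distribution) =
      mean_F2 (smoothed \<eta> U) q"
    using ev eventually_assumption1_smoothed[OF A]
    by eventually_elim (use q in \<open>simp add: mean_F2_def w_def F_smoothed[OF A]\<close>)
  ultimately show "((\<lambda>\<eta>. mean_F2 (smoothed \<eta> U) q) \<longlongrightarrow> mean_F2 U q) (at_right 0)"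
    unfolding at mean_F2_def[of U] w0 using q by (simp add: F_eq[OF A] Lim_transform_eventually)
qed

section \<open>The constant \<open>C\<^sub>1\<close> under smoothing\<close>

lemma c1_bar_eq: "c1_bar U = max 2 (SUP c\<in>{1/2..2}. 1 / smoothed c U 0)"
  by (simp add: c1_bar_def smoothed_def)

text \<open>
  Conditionally complete suprema give an upper bound only for bounded sets; boundedness comes from
  the Gaussian lower bound at \<open>x = 0\<close>.
\<close>
lemma inverse_smoothed_le_c1_bar:
  assumes A: "assumption1 U" and c: "c \<in> {1/2..2}"
  shows "1 / smoothed c U 0 \<le> c1_bar U"
proof -
  obtain m where "0 < m" and lower: "\<forall>\<sigma>\<in>{1/2..2}. \<forall>x. m * exp (- x\<^sup>2 / \<sigma>\<^sup>2) \<le> smoothed \<sigma> U x"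
    using smoothed_gaussian_lower_bound[OF A, of "1/2" 2] by auto
  then have m: "0 < m" "m \<le> smoothed c U 0" if "c \<in> {1/2..2}" for c
    using lower[rule_format, OF that, of 0] by simp_all
  have "bdd_above ((\<lambda>c. 1 / smoothed c U 0) ` {1/2..2})"
  proof (rule bdd_aboveI)
    fix y assume "y \<in> (\<lambda>c. 1 / smoothed c U 0) ` {1/2..2}"
    then obtain c where "c \<in> {1/2..2}" "y = 1 / smoothed c U 0"
      by blast
    then show "y \<le> 1 / m"
      using m[of c] by (simp add: frac_le)
  qed
  then have "1 / smoothed c U 0 \<le> (SUP c\<in>{1/2..2}. 1 / smoothed c U 0)"
    using c by (rule cSUP_upper2[where x=c]) simp
  then show ?thesis
    by (simp add: c1_bar_eq)
qed

text \<open>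
  Smoothing turns the width \<open>c\<close> into \<open>sqrt (c\<^sup>2 + \<eta>\<^sup>2)\<close>, which is within \<open>\<eta>\<close> of \<open>c\<close>. The inverse mean
  is uniformly continuous on the slightly larger range of widths \<open>{1/2..3}\<close>, so the supremum
  can increase only a little.
\<close>
lemma eventually_c1_bar_smoothed_le:
  assumes A: "assumption1 U" and e: "0 < e"
  shows "\<forall>\<^sub>F \<eta> in at_right 0. c1_bar (smoothed \<eta> U) \<le> c1_bar U + e"
proof -
  have U: "unit_valued U" using A by (rule assumption1_unit_valued)
  define f where "f c = 1 / smoothed c U 0" for c
  have "isCont f c" if "c \<in> {1/2..3}" for c
    unfolding f_def using that smoothed_pos[OF A, of c 0]
    by (intro continuous_intros isCont_smoothed_width(1)[OF U]) auto
  then have "continuous_on {1/2..3} f"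
    by (intro continuous_at_imp_continuous_on) auto
  then have "uniformly_continuous_on {1/2..3} f"
    by (rule compact_uniformly_continuous) simp
  then obtain d where d: "0 < d"
    "\<And>c c'. c \<in> {1/2..3} \<Longrightarrow> c' \<in> {1/2..3} \<Longrightarrow> dist c' c < d \<Longrightarrow> dist (f c') (f c) < e"
    using e unfolding uniformly_continuous_on_def by metis
  have "\<forall>\<^sub>F \<eta> in at_right 0. \<eta> < min d 1"
    using d(1) by (intro order_tendstoD(2)[OF tendsto_ident_at]) auto
  moreover have "\<forall>\<^sub>F \<eta> in at_right 0. (0::real) < \<eta>"
    by (rule eventually_at_right_less)
  ultimately show ?thesis
  proof eventually_elim
    case (elim \<eta>)
    have "1 / smoothed c (smoothed \<eta> U) 0 \<le> c1_bar U + e" if c: "c \<in> {1/2..2}" for c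
    proof -
      let ?c = "sqrt (c\<^sup>2 + \<eta>\<^sup>2)"
      have "c \<le> ?c" "?c \<le> c + \<eta>"
        using c elim by (auto intro!: real_le_rsqrt sqrt_sum_squares_le_sum)
      moreover from this have "?c \<in> {1/2..3}" "dist ?c c < d"
        using c elim unfolding atLeastAtMost_iff dist_real_def by linarith+
      ultimately have "dist (f ?c) (f c) < e"
        using c by (intro d(2)) auto
      moreover have "f c \<le> c1_bar U"
        unfolding f_def using A c by (rule inverse_smoothed_le_c1_bar)
      moreover have "1 / smoothed c (smoothed \<eta> U) 0 = f ?c"
        using c elim U by (simp add: f_def smoothed_smoothed)
      ultimately show ?thesis
        by (auto simp: dist_real_def)
    qed
    then have "(SUP c\<in>{1/2..2}. 1 / smoothed c (smoothed \<eta> U) 0) \<le> c1_bar U + e"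
      by (intro cSUP_least) auto
    moreover have "2 \<le> c1_bar U"
      by (simp add: c1_bar_eq)
    ultimately show ?case
      using e unfolding c1_bar_eq[of "smoothed \<eta> U"] by simp
  qed
qed

text \<open>
  \<^const>\<open>C1\<close> is a continuous increasing function of \<^const>\<open>c1_bar\<close>. The factor 2 is far from sharp;
  its sixth power is absorbed by the factor \<open>exp 16\<close> in \<^const>\<open>alpha'\<close>.
\<close>
lemma eventually_C1_smoothed_le:
  assumes A: "assumption1 U" and c0: "0 < c0"
  shows "\<forall>\<^sub>F \<eta> in at_right 0. C1 c0 (smoothed \<eta> U) \<le> 2 * C1 c0 U"
proof -
  \<comment> \<open>The exponent is abstracted so that simplification does not expand the power.\<close>
  define n :: nat where "n = 200"
  define g where "g b = (4 * sqrt (8 * ln b)) ^ n + c0 * b" for b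
  have C1: "C1 c0 V = g (c1_bar V)" for V
    unfolding C1_def K0_def g_def n_def ..
  have b: "2 \<le> c1_bar V" for V
    by (simp add: c1_bar_eq)
  have "0 < g (c1_bar U)"
    unfolding g_def using b[of U] c0 by (intro add_nonneg_pos) auto
  moreover have "isCont g (c1_bar U)"
    unfolding g_def using b[of U] by (intro continuous_intros) auto
  then have "(g \<longlongrightarrow> g (c1_bar U)) (at_right (c1_bar U))"
    by (simp add: isCont_def filterlim_at_split)
  ultimately have "\<forall>\<^sub>F b in at_right (c1_bar U). g b < 2 * g (c1_bar U)"
    by (intro order_tendstoD(2)) auto
  then obtain b' where b': "c1_bar U < b'" "\<And>b. c1_bar U < b \<Longrightarrow> b < b' \<Longrightarrow> g b < 2 * g (c1_bar U)"
    unfolding eventually_at_right_field by auto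
  define e where "e = (b' - c1_bar U) / 2"
  have e: "0 < e" "g (c1_bar U + e) < 2 * g (c1_bar U)"
    using b' by (auto simp: e_def field_simps)
  show ?thesis
    using eventually_c1_bar_smoothed_le[OF A e(1)]
  proof eventually_elim
    case (elim \<eta>)
    have "g (c1_bar (smoothed \<eta> U)) \<le> g (c1_bar U + e)"
      unfolding g_def using elim b[of "smoothed \<eta> U"] b[of U] e(1) c0
      by (intro add_mono power_mono mult_left_mono) auto
    with e(2) show ?case
      by (simp add: C1)
  qed
qed

lemma C1_bounds:
  assumes c0: "5 \<le> c0"
  shows "c1_bar U \<le> C1 c0 U" and "1 \<le> C1 c0 U"
proof -
  have "2 \<le> c1_bar U"
    by (simp add: c1_bar_eq)
  moreover have "1 * c1_bar U \<le> c0 * c1_bar U"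
    using calculation c0 by (intro mult_right_mono) auto
  moreover have "0 \<le> (4 * K0 U) ^ 200"
    by (rule zero_le_even_power) simp
  ultimately show "c1_bar U \<le> C1 c0 U" "1 \<le> C1 c0 U"
    unfolding C1_def by linarith+
qed

section \<open>Gaussian means as functions of the variance\<close>

text \<open>
  Under the derivative bounds both \<open>f\<close> and \<open>C x\<^sup>2 - f\<close> are nondecreasing on the positive half-line.
  Lipschitz continuity in \<open>x\<^sup>2\<close> rather than \<open>x\<close> is the right notion here, since \<open>\<psi>\<close>
  enters through \<open>(sqrt \<psi> z)\<^sup>2 = \<psi> z\<^sup>2\<close>.
\<close>
lemma even_lipschitz_in_square:
  fixes f f' :: "real \<Rightarrow> real"
  assumes even: "\<And>x. f (- x) = f x"
    and deriv: "\<And>x. (f has_real_derivative f' x) (at x)"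
    and f': "\<And>x. 0 \<le> x \<Longrightarrow> 0 \<le> f' x" "\<And>x. 0 \<le> x \<Longrightarrow> f' x \<le> 2 * C * x"
  shows "\<bar>f a - f b\<bar> \<le> C * \<bar>a\<^sup>2 - b\<^sup>2\<bar>"
proof -
  have *: "0 \<le> f y - f x \<and> f y - f x \<le> C * (y\<^sup>2 - x\<^sup>2)" if "0 \<le> x" "x \<le> y" for x y
  proof -
    have "f x \<le> f y"
      using that deriv f'(1) by (intro DERIV_nonneg_imp_nondecreasing[OF that(2)]) (meson order_trans)
    moreover have "C * x\<^sup>2 - f x \<le> C * y\<^sup>2 - f y"
    proof (rule DERIV_nonneg_imp_nondecreasing[OF that(2)])
      fix t assume "x \<le> t" "t \<le> y"
      moreover have "((\<lambda>x. C * x\<^sup>2 - f x) has_real_derivative 2 * C * t - f' t) (at t)"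
        by (auto intro!: derivative_eq_intros deriv)
      ultimately show "\<exists>d. ((\<lambda>x. C * x\<^sup>2 - f x) has_real_derivative d) (at t) \<and> 0 \<le> d"
        using that f'(2)[of t] by auto
    qed
    ultimately show ?thesis
      by (simp add: algebra_simps)
  qed
  have abs: "f \<bar>x\<bar> = f x" for x
    by (simp add: abs_if even)
  have main: "\<bar>f a - f b\<bar> \<le> C * \<bar>a\<^sup>2 - b\<^sup>2\<bar>" if "\<bar>a\<bar> \<le> \<bar>b\<bar>" for a b
    using *[of "\<bar>a\<bar>" "\<bar>b\<bar>"] that by (simp add: abs abs_le_square_iff)
  show ?thesis
  proof (cases "\<bar>a\<bar> \<le> \<bar>b\<bar>")
    case False
    then show ?thesis
      using main[of b a] by (simp add: abs_minus_commute)
  qed (rule main)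
qed

lemma tanh_real_le:
  fixes x :: real
  assumes "0 \<le> x"
  shows "tanh x \<le> x"
proof -
  have "0 - tanh 0 \<le> x - tanh x"
  proof (rule DERIV_nonneg_imp_nondecreasing[OF assms])
    fix t :: real
    have "((\<lambda>x. x - tanh x) has_real_derivative 1 - (1 - (tanh t)\<^sup>2)) (at t)"
      by (auto intro!: derivative_eq_intros simp: cosh_real_pos less_imp_neq[symmetric])
    then show "\<exists>d. ((\<lambda>x. x - tanh x) has_real_derivative d) (at t) \<and> 0 \<le> d"
      by auto
  qed
  then show ?thesis by simp
qed

lemma tanh_square_lipschitz: "\<bar>(tanh a)\<^sup>2 - (tanh b)\<^sup>2\<bar> \<le> \<bar>a\<^sup>2 - b\<^sup>2\<bar>" for a b :: real
proof -
  have sq: "(tanh x)\<^sup>2 \<le> 1" for x :: real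
    using tanh_real_bounds[of x] unfolding abs_square_le_1 by (auto simp: abs_le_iff)
  have "\<bar>(tanh a)\<^sup>2 - (tanh b)\<^sup>2\<bar> \<le> 1 * \<bar>a\<^sup>2 - b\<^sup>2\<bar>"
  proof (rule even_lipschitz_in_square)
    show "((\<lambda>x. (tanh x)\<^sup>2) has_real_derivative 2 * tanh x * (1 - (tanh x)\<^sup>2)) (at x)" for x :: real
      by (auto intro!: derivative_eq_intros simp: cosh_real_pos less_imp_neq[symmetric])
    show "0 \<le> 2 * tanh x * (1 - (tanh x)\<^sup>2)" if "0 \<le> x" for x :: real
      using that sq[of x] by (intro mult_nonneg_nonneg) auto
    show "2 * tanh x * (1 - (tanh x)\<^sup>2) \<le> 2 * 1 * x" if "0 \<le> x" for x :: real
    proof -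
      have "2 * tanh x * (1 - (tanh x)\<^sup>2) \<le> 2 * x * 1"
        using that sq[of x] tanh_real_le[OF that] by (intro mult_mono) auto
      then show ?thesis by simp
    qed
  qed simp
  then show ?thesis by simp
qed

lemma ln_2_cosh_lipschitz: "\<bar>ln (2 * cosh a) - ln (2 * cosh b)\<bar> \<le> 1 / 2 * \<bar>a\<^sup>2 - b\<^sup>2\<bar>" for a b :: real
proof (rule even_lipschitz_in_square)
  show "((\<lambda>x. ln (2 * cosh x)) has_real_derivative tanh x) (at x)" for x :: real
    using cosh_real_pos[of x] by (auto intro!: derivative_eq_intros simp: tanh_def field_simps)
qed (auto simp: tanh_real_le)

text \<open>
  The integrands differ by at most \<open>C \<bar>\<psi> - \<psi>'\<bar> z\<^sup>2\<close>, and \<open>z\<^sup>2\<close> has mean 1.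
\<close>
lemma gaussian_mean_lipschitz:
  fixes f :: "real \<Rightarrow> real"
  assumes [measurable]: "f \<in> borel_measurable borel"
    and lip: "\<And>a b. \<bar>f a - f b\<bar> \<le> C * \<bar>a\<^sup>2 - b\<^sup>2\<bar>"
    and "0 \<le> \<psi>" "0 \<le> \<psi>'"
  shows "integrable std_normal_distribution (\<lambda>z. f (sqrt \<psi> * z))"
    and "\<bar>(\<integral>z. f (sqrt \<psi> * z) \<partial>std_normal_distribution) -
      (\<integral>z. f (sqrt \<psi>' * z) \<partial>std_normal_distribution)\<bar> \<le> C * \<bar>\<psi> - \<psi>'\<bar>"
proof -
  interpret prob_space std_normal_distribution by (rule prob_space_std_normal)
  have sq: "integrable std_normal_distribution (\<lambda>z. z\<^sup>2)" "(\<integral>z. z\<^sup>2 \<partial>std_normal_distribution) = 1"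
    using std_normal_distribution_even_moments[of 1] by simp_all
  have diff: "\<bar>f (sqrt s * z) - f (sqrt t * z)\<bar> \<le> C * \<bar>s - t\<bar> * z\<^sup>2" if "0 \<le> s" "0 \<le> t" for s t z
    using lip[of "sqrt s * z" "sqrt t * z"] that
    by (simp add: power_mult_distrib left_diff_distrib[symmetric] abs_mult mult.assoc)
  have int: "integrable std_normal_distribution (\<lambda>z. f (sqrt s * z))" if s: "0 \<le> s" for s
  proof (rule Bochner_Integration.integrable_bound)
    show "integrable std_normal_distribution (\<lambda>z. \<bar>f 0\<bar> + C * s * z\<^sup>2)"
      using sq by (intro Bochner_Integration.integrable_add integrable_mult_right) auto
    show "AE z in std_normal_distribution. norm (f (sqrt s * z)) \<le> norm (\<bar>f 0\<bar> + C * s * z\<^sup>2)"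
    proof (rule AE_I2)
      fix z
      show "norm (f (sqrt s * z)) \<le> norm (\<bar>f 0\<bar> + C * s * z\<^sup>2)"
        using diff[OF s order_refl, of z] s by simp
    qed
  qed auto
  then show "integrable std_normal_distribution (\<lambda>z. f (sqrt \<psi> * z))"
    using \<open>0 \<le> \<psi>\<close> .
  have "\<bar>\<integral>z. f (sqrt \<psi> * z) - f (sqrt \<psi>' * z) \<partial>std_normal_distribution\<bar> \<le>
      (\<integral>z. \<bar>f (sqrt \<psi> * z) - f (sqrt \<psi>' * z)\<bar> \<partial>std_normal_distribution)"
    by (rule integral_abs_bound)
  also have "\<dots> \<le> (\<integral>z. C * \<bar>\<psi> - \<psi>'\<bar> * z\<^sup>2 \<partial>std_normal_distribution)"
    using sq(1) int[OF assms(3)] int[OF assms(4)] diff[OF assms(3,4)]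
    by (intro integral_mono integrable_abs Bochner_Integration.integrable_diff integrable_mult_right)
  also have "\<dots> = C * \<bar>\<psi> - \<psi>'\<bar>"
    using sq by simp
  finally show "\<bar>(\<integral>z. f (sqrt \<psi> * z) \<partial>std_normal_distribution) -
      (\<integral>z. f (sqrt \<psi>' * z) \<partial>std_normal_distribution)\<bar> \<le> C * \<bar>\<psi> - \<psi>'\<bar>"
    using int[OF assms(3)] int[OF assms(4)] by (simp add: Bochner_Integration.integral_diff)
qed

section \<open>The replica symmetric equation\<close>

text \<open>
  The map \<open>q \<mapsto> P (\<alpha> G q)\<close> has Lipschitz constant \<open>1/2\<close>. It preserves \<open>{0..b}\<close>: its values are at
  most \<open>\<alpha> G q \<le> b/2 + q/2 \<le> b\<close>.
\<close>
lemma contraction_unique_fixpoint: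
  fixes P G :: "real \<Rightarrow> real"
  assumes P: "\<And>x y. 0 \<le> x \<Longrightarrow> 0 \<le> y \<Longrightarrow> \<bar>P x - P y\<bar> \<le> \<bar>x - y\<bar>" "P 0 = 0" "\<And>x. 0 \<le> P x"
    and G: "\<And>q. 0 \<le> G q" and \<alpha>: "0 \<le> \<alpha>" and b: "0 \<le> b"
    and lip: "\<And>q q'. q \<in> {0..b} \<Longrightarrow> q' \<in> {0..b} \<Longrightarrow> \<alpha> * \<bar>G q - G q'\<bar> \<le> 1 / 2 * \<bar>q - q'\<bar>"
    and G0: "\<alpha> * G 0 \<le> b / 2"
  shows "\<exists>!q. q \<in> {0..b} \<and> P (\<alpha> * G q) = q"
proof -
  have "\<exists>!q\<in>{0..b}. P (\<alpha> * G q) = q"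
  proof (rule Banach_fix[where c="1/2"])
    show "dist (P (\<alpha> * G q)) (P (\<alpha> * G q')) \<le> 1 / 2 * dist q q'" if "q \<in> {0..b}" "q' \<in> {0..b}" for q q'
    proof -
      have "\<bar>P (\<alpha> * G q) - P (\<alpha> * G q')\<bar> \<le> \<bar>\<alpha> * G q - \<alpha> * G q'\<bar>"
        using G \<alpha> by (intro P) auto
      also have "\<dots> = \<alpha> * \<bar>G q - G q'\<bar>"
        using \<alpha> by (simp add: abs_mult flip: right_diff_distrib)
      also note lip[OF that]
      finally show ?thesis by (simp add: dist_real_def)
    qed
    show "(\<lambda>q. P (\<alpha> * G q)) ` {0..b} \<subseteq> {0..b}"
    proof (rule image_subsetI)
      fix q assume q: "q \<in> {0..b}"
      have "P (\<alpha> * G q) \<le> \<alpha> * G q"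
        using P(1)[of "\<alpha> * G q" 0] P(2,3) G[of q] \<alpha> by simp
      moreover have "\<alpha> * (G q - G 0) \<le> \<alpha> * \<bar>G q - G 0\<bar>"
        using \<alpha> by (intro mult_left_mono) auto
      moreover have "\<alpha> * \<bar>G q - G 0\<bar> \<le> 1 / 2 * q"
        using lip[of q 0] q b by simp
      ultimately have "P (\<alpha> * G q) \<le> b"
        using G0 q by (simp add: right_diff_distrib)
      then show "P (\<alpha> * G q) \<in> {0..b}"
        using P(3) by simp
    qed
  qed (use b in \<open>auto simp: complete_eq_closed\<close>)
  then show ?thesis .
qed

definition overlap :: "real \<Rightarrow> real" where
  "overlap \<psi> = (\<integral>z. (tanh (sqrt \<psi> * z))\<^sup>2 \<partial>std_normal_distribution)"

definition mean_ln_cosh :: "real \<Rightarrow> real" where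
  "mean_ln_cosh \<psi> = (\<integral>z. ln (2 * cosh (sqrt \<psi> * z)) \<partial>std_normal_distribution)"

lemma borel_measurable_tanh_square: "(\<lambda>x::real. (tanh x)\<^sup>2) \<in> borel_measurable borel"
  and borel_measurable_ln_2_cosh: "(\<lambda>x::real. ln (2 * cosh x)) \<in> borel_measurable borel"
  by (intro borel_measurable_continuous_onI continuous_intros; simp)+

lemma overlap_lipschitz: "0 \<le> x \<Longrightarrow> 0 \<le> y \<Longrightarrow> \<bar>overlap x - overlap y\<bar> \<le> \<bar>x - y\<bar>"
  using gaussian_mean_lipschitz(2)[OF borel_measurable_tanh_square, of 1 x y] tanh_square_lipschitz
  unfolding overlap_def by simp

lemma mean_ln_cosh_lipschitz:
  "0 \<le> x \<Longrightarrow> 0 \<le> y \<Longrightarrow> \<bar>mean_ln_cosh x - mean_ln_cosh y\<bar> \<le> 1 / 2 * \<bar>x - y\<bar>"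
  unfolding mean_ln_cosh_def
  by (rule gaussian_mean_lipschitz(2)[OF borel_measurable_ln_2_cosh ln_2_cosh_lipschitz])

lemma integrable_ln_cosh:
  "0 \<le> \<psi> \<Longrightarrow> integrable std_normal_distribution (\<lambda>z. ln (2 * cosh (sqrt \<psi> * z)))"
  by (rule gaussian_mean_lipschitz(1)[OF borel_measurable_ln_2_cosh ln_2_cosh_lipschitz])

lemma overlap_0: "overlap 0 = 0" and overlap_nonneg: "0 \<le> overlap \<psi>"
  by (simp_all add: overlap_def)

lemma mean_F2_nonneg: "0 \<le> mean_F2 U q"
  by (simp add: mean_F2_def)

text \<open>
  The equations for \<open>(q, \<psi>)\<close> determine \<open>\<psi>\<close> from \<open>q\<close>; this is the \<open>q\<close> that solves the single
  equation left after eliminating \<open>\<psi>\<close>.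
\<close>
definition rs_overlap :: "real \<Rightarrow> (real \<Rightarrow> real) \<Rightarrow> real" where
  "rs_overlap \<alpha> U = (THE q. q \<in> {0..1/25} \<and> overlap (\<alpha> * mean_F2 U q) = q)"

lemma is_rs_pair_iff:
  assumes "0 \<le> \<alpha>"
  shows "is_rs_pair \<alpha> U q \<psi> \<longleftrightarrow>
    (q \<in> {0..1/25} \<and> overlap (\<alpha> * mean_F2 U q) = q) \<and> \<psi> = \<alpha> * mean_F2 U q"
  using assms mean_F2_nonneg[of U q]
  unfolding is_rs_pair_def overlap_def[symmetric] mean_F2_def[symmetric] by auto

lemma RS_eq:
  assumes A: "assumption1 U" and \<alpha>: "0 \<le> \<alpha>"
    and ex1: "\<exists>!q. q \<in> {0..1/25} \<and> overlap (\<alpha> * mean_F2 U q) = q"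
    and q: "q = rs_overlap \<alpha> U" and \<psi>: "\<psi> = \<alpha> * mean_F2 U q"
  shows "RS \<alpha> U = - (\<psi> * (1 - q)) / 2 + (mean_ln_cosh \<psi> + \<alpha> * mean_L U q)"
proof -
  have fixp: "q \<in> {0..1/25} \<and> overlap (\<alpha> * mean_F2 U q) = q"
    unfolding q rs_overlap_def by (rule theI'[OF ex1])
  have "(THE (q, \<psi>). is_rs_pair \<alpha> U q \<psi>) = (q, \<psi>)"
    using fixp ex1 \<psi> by (intro the_equality) (auto simp: is_rs_pair_iff[OF \<alpha>])
  moreover have "0 \<le> \<psi>"
    using \<alpha> mean_F2_nonneg by (simp add: \<psi>)
  then have "(\<integral>z. ln (2 * cosh (sqrt \<psi> * z)) + \<alpha> * L U q (sqrt q * z) \<partial>std_normal_distribution) =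
      mean_ln_cosh \<psi> + \<alpha> * mean_L U q"
    unfolding mean_ln_cosh_def mean_L_def using fixp
    by (simp add: Bochner_Integration.integral_add integrable_ln_cosh integrable_mult_right integrable_L[OF A])
  ultimately show ?thesis
    unfolding RS_def by simp
qed

text \<open>
  The derivative bounds that define \<open>c1\<close>, integrated over an interval. In this form they say by how
  much the right-hand side of the fixed point equation contracts.
\<close>
lemma mean_F2_mean_L_lipschitz:
  assumes c1: "admissible_c1 c0 c1" and A: "assumption1 U" and q: "q \<in> {0..1/2}" "q' \<in> {0..1/2}"
  shows "\<bar>mean_F2 U q - mean_F2 U q'\<bar> \<le> c1 * C1 c0 U ^ 6 * \<bar>q - q'\<bar>"
    and "\<bar>mean_L U q - mean_L U q'\<bar> \<le> c1 * C1 c0 U ^ 2 * \<bar>q - q'\<bar>"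
proof -
  have sub: "{0..1/2} \<subseteq> {0..<1::real}" by auto
  have "\<forall>q\<in>{0..1/2}. \<exists>D. (mean_F2 U has_real_derivative D) (at q within {0..1/2}) \<and> \<bar>D\<bar> \<le> c1 * C1 c0 U ^ 6"
    using c1 A unfolding admissible_c1_def mean_F2_def[abs_def] by (meson DERIV_subset sub)
  then obtain D where "\<And>q. q \<in> {0..1/2} \<Longrightarrow> (mean_F2 U has_real_derivative D q) (at q within {0..1/2})"
      "\<And>q. q \<in> {0..1/2} \<Longrightarrow> \<bar>D q\<bar> \<le> c1 * C1 c0 U ^ 6"
    by metis
  then have "norm (mean_F2 U q - mean_F2 U q') \<le> c1 * C1 c0 U ^ 6 * norm (q - q')"
    using q by (intro field_differentiable_bound[where S="{0..1/2}"]) auto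
  then show "\<bar>mean_F2 U q - mean_F2 U q'\<bar> \<le> c1 * C1 c0 U ^ 6 * \<bar>q - q'\<bar>"
    by simp
  have "\<forall>q\<in>{0..1/2}. \<exists>D. (mean_L U has_real_derivative D) (at q within {0..1/2}) \<and> \<bar>D\<bar> \<le> c1 * C1 c0 U ^ 2"
    using c1 A unfolding admissible_c1_def mean_L_def[abs_def] by (meson DERIV_subset sub)
  then obtain D where "\<And>q. q \<in> {0..1/2} \<Longrightarrow> (mean_L U has_real_derivative D q) (at q within {0..1/2})"
      "\<And>q. q \<in> {0..1/2} \<Longrightarrow> \<bar>D q\<bar> \<le> c1 * C1 c0 U ^ 2"
    by metis
  then have "norm (mean_L U q - mean_L U q') \<le> c1 * C1 c0 U ^ 2 * norm (q - q')"
    using q by (intro field_differentiable_bound[where S="{0..1/2}"]) auto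
  then show "\<bar>mean_L U q - mean_L U q'\<bar> \<le> c1 * C1 c0 U ^ 2 * \<bar>q - q'\<bar>"
    by simp
qed

text \<open>
  At \<open>q = 0\<close> the argument of \<open>F\<close> is \<open>0\<close>, so the mean is the square of a single quotient, whose
  denominator is controlled by \<^const>\<open>c1_bar\<close>.
\<close>
lemma mean_F2_0_le:
  assumes A: "assumption1 U" and c0: "5 \<le> c0"
  shows "mean_F2 U 0 \<le> (C1 c0 U)\<^sup>2"
proof -
  interpret prob_space std_normal_distribution by (rule prob_space_std_normal)
  have "\<bar>smoothed_slope 1 U 0\<bar> * (1 / smoothed 1 U 0) \<le> 1 * C1 c0 U"
    using abs_smoothed_slope_le[OF assumption1_unit_valued[OF A], of 1 0]
      inverse_smoothed_le_c1_bar[OF A, of 1] C1_bounds(1)[OF c0, of U] smoothed_pos[OF A, of 1 0]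
    by (intro mult_mono) auto
  then have "\<bar>F U 0 0\<bar> \<le> \<bar>C1 c0 U\<bar>"
    using smoothed_pos[OF A, of 1 0] by (simp add: F_eq[OF A] abs_divide)
  then have "(F U 0 0)\<^sup>2 \<le> (C1 c0 U)\<^sup>2"
    by (simp only: abs_le_square_iff)
  moreover have "mean_F2 U 0 = (F U 0 0)\<^sup>2"
    unfolding mean_F2_def using prob_space by simp
  ultimately show ?thesis by simp
qed

text \<open>
  As \<open>c1\<close> and \<^const>\<open>C1\<close> are at least 1, the product \<open>c1 C1\<^sup>6\<close> dominates the two Lipschitz constants and
  the value of \<^const>\<open>mean_F2\<close> at \<open>0\<close> simultaneously.
\<close>
lemma small_load_bounds:
  assumes c0: "5 \<le> c0" and c1: "admissible_c1 c0 c1" and A: "assumption1 U"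
    and \<alpha>: "0 \<le> \<alpha>" and small: "\<alpha> * (c1 * C1 c0 U ^ 6) \<le> 1 / 50"
    and q: "q \<in> {0..1/25}" "q' \<in> {0..1/25}"
  shows "\<alpha> * \<bar>mean_F2 U q - mean_F2 U q'\<bar> \<le> 1 / 2 * \<bar>q - q'\<bar>"
    and "\<alpha> * \<bar>mean_L U q - mean_L U q'\<bar> \<le> 1 / 2 * \<bar>q - q'\<bar>"
    and "\<alpha> * mean_F2 U 0 \<le> 1 / 50"
proof -
  have q': "q \<in> {0..1/2}" "q' \<in> {0..1/2}" using q by auto
  have "1 \<le> c1" using c1 by (simp add: admissible_c1_def)
  have pow: "C1 c0 U ^ 2 \<le> C1 c0 U ^ 6"
    using C1_bounds(2)[OF c0] by (intro power_increasing) auto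
  have pow2: "c1 * C1 c0 U ^ 2 \<le> c1 * C1 c0 U ^ 6"
    using pow \<open>1 \<le> c1\<close> by (intro mult_left_mono) auto
  have lip: "\<alpha> * x \<le> 1 / 2 * \<bar>q - q'\<bar>" if x: "x \<le> c1 * C1 c0 U ^ 6 * \<bar>q - q'\<bar>" for x
  proof -
    have "\<alpha> * x \<le> \<alpha> * (c1 * C1 c0 U ^ 6) * \<bar>q - q'\<bar>"
      using mult_left_mono[OF x \<alpha>] by (simp add: mult.assoc)
    also have "\<dots> \<le> 1 / 2 * \<bar>q - q'\<bar>"
      using small by (intro mult_right_mono) auto
    finally show ?thesis .
  qed
  show "\<alpha> * \<bar>mean_F2 U q - mean_F2 U q'\<bar> \<le> 1 / 2 * \<bar>q - q'\<bar>"
    using mean_F2_mean_L_lipschitz(1)[OF c1 A q'] by (rule lip)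
  have "\<bar>mean_L U q - mean_L U q'\<bar> \<le> c1 * C1 c0 U ^ 6 * \<bar>q - q'\<bar>"
    using mean_F2_mean_L_lipschitz(2)[OF c1 A q'] mult_right_mono[OF pow2, of "\<bar>q - q'\<bar>"] by simp
  then show "\<alpha> * \<bar>mean_L U q - mean_L U q'\<bar> \<le> 1 / 2 * \<bar>q - q'\<bar>"
    by (rule lip)
  have "C1 c0 U ^ 2 \<le> c1 * C1 c0 U ^ 2"
    using \<open>1 \<le> c1\<close> mult_right_mono[of 1 c1 "C1 c0 U ^ 2"] by simp
  then have "mean_F2 U 0 \<le> c1 * C1 c0 U ^ 6"
    using mean_F2_0_le[OF A c0] pow2 by linarith
  then have "\<alpha> * mean_F2 U 0 \<le> \<alpha> * (c1 * C1 c0 U ^ 6)"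
    using \<alpha> by (rule mult_left_mono)
  with small show "\<alpha> * mean_F2 U 0 \<le> 1 / 50"
    by linarith
qed

lemma rs_overlap_ex1:
  assumes "5 \<le> c0" "admissible_c1 c0 c1" "assumption1 U" "0 \<le> \<alpha>" "\<alpha> * (c1 * C1 c0 U ^ 6) \<le> 1 / 50"
  shows "\<exists>!q. q \<in> {0..1/25} \<and> overlap (\<alpha> * mean_F2 U q) = q"
  using small_load_bounds(1)[OF assms] small_load_bounds(3)[OF assms, of 0 0] assms(4)
  by (intro contraction_unique_fixpoint overlap_lipschitz overlap_0 overlap_nonneg mean_F2_nonneg) simp_all

text \<open>
  The smallness comes from the factor \<open>exp 16 \<ge> 2 ^ 16\<close> in \<^const>\<open>alpha'\<close>, as \<open>(K\<^sub>2)' \<ge> 1\<close>. If \<open>(K\<^sub>2)'\<close> is infinite then \<open>\<alpha> = 0\<close>.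
\<close>
lemma alpha'_small:
  assumes c0: "5 \<le> c0" and c1: "1 \<le> c1" and \<alpha>: "0 \<le> \<alpha>" "\<alpha> \<le> alpha' c0 c1 U"
  shows "\<alpha> * (c1 * C1 c0 U ^ 6) \<le> 1 / 65536"
proof (cases "K2' U = \<infinity>")
  case True
  with \<alpha> show ?thesis by (simp add: alpha'_def)
next
  case False
  have "1 \<le> K2' U" by (simp add: K2'_def)
  with False have K: "1 \<le> real_of_ereal (K2' U)"
    by (cases "K2' U") auto
  let ?K = "real_of_ereal (K2' U) ^ 4"
  have K4: "1 \<le> ?K" using K by (rule one_le_power)
  have C: "0 < c1 * C1 c0 U ^ 6"
    using c1 C1_bounds(2)[OF c0, of U] by (intro mult_pos_pos zero_less_power) auto
  have "(2::real) \<le> exp 1"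
    using exp_ge_add_one_self[of 1] by simp
  then have "(2::real) ^ 16 \<le> exp 1 ^ 16"
    by (intro power_mono) auto
  also have "\<dots> = exp 16"
    by (simp flip: exp_of_nat_mult)
  finally have e: "65536 \<le> exp (16::real)"
    by simp
  have "\<alpha> * (c1 * C1 c0 U ^ 6) \<le> 1 / (exp 16 * c1 * C1 c0 U ^ 6 * ?K) * (c1 * C1 c0 U ^ 6)"
    using \<alpha> False C by (intro mult_right_mono) (auto simp: alpha'_def)
  also have "\<dots> = 1 / (exp 16 * ?K)"
  proof -
    have "1 / (e * c * C * k) * (c * C) = 1 / (e * k)" if "0 < c * C" for e c C k :: real
      using that by (auto simp: field_simps)
    then show ?thesis using C .
  qed
  also have "\<dots> \<le> 1 / (65536 * 1)"
    using e K4 by (intro divide_left_mono mult_mono mult_pos_pos) auto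
  finally show ?thesis by simp
qed

section \<open>Continuity under smoothing\<close>

text \<open>
  Equicontinuity lets a pointwise limit be taken at a point that moves with the parameter. The
  Lipschitz bound concerns \<open>\<alpha> f\<close> because the smallness of \<open>\<alpha>\<close> is what makes its constant \<open>1/2\<close>.
\<close>
lemma tendsto_at_moving_point:
  fixes f :: "'a \<Rightarrow> real \<Rightarrow> real"
  assumes lip: "\<forall>\<^sub>F \<eta> in X. \<alpha> * \<bar>f \<eta> (q \<eta>) - f \<eta> q0\<bar> \<le> 1 / 2 * \<bar>q \<eta> - q0\<bar>"
    and q: "(q \<longlongrightarrow> q0) X" and f: "((\<lambda>\<eta>. f \<eta> q0) \<longlongrightarrow> l) X" and \<alpha>: "0 \<le> \<alpha>"
  shows "((\<lambda>\<eta>. \<alpha> * f \<eta> (q \<eta>)) \<longlongrightarrow> \<alpha> * l) X"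
proof -
  have "((\<lambda>\<eta>. \<alpha> * (f \<eta> (q \<eta>) - f \<eta> q0)) \<longlongrightarrow> 0) X"
  proof (rule Lim_null_comparison)
    show "\<forall>\<^sub>F \<eta> in X. norm (\<alpha> * (f \<eta> (q \<eta>) - f \<eta> q0)) \<le> 1 / 2 * \<bar>q \<eta> - q0\<bar>"
      using lip \<alpha> by (simp add: abs_mult)
    have "((\<lambda>\<eta>. 1 / 2 * \<bar>q \<eta> - q0\<bar>) \<longlongrightarrow> 1 / 2 * \<bar>q0 - q0\<bar>) X"
      by (intro tendsto_intros q)
    then show "((\<lambda>\<eta>. 1 / 2 * \<bar>q \<eta> - q0\<bar>) \<longlongrightarrow> 0) X"
      by simp
  qed
  then have "((\<lambda>\<eta>. \<alpha> * (f \<eta> (q \<eta>) - f \<eta> q0) + \<alpha> * f \<eta> q0) \<longlongrightarrow> 0 + \<alpha> * l) X"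
    by (intro tendsto_intros f)
  then show ?thesis
    by (simp add: algebra_simps)
qed

text \<open>
  Fixed points of uniform contractions depend continuously on the map: the distance of the two fixed
  points is at most half of itself plus the difference of the two maps at the limiting fixed point
  alone. So pointwise convergence there is enough.
\<close>
lemma tendsto_rs_overlap:
  assumes ex1: "\<exists>!q. q \<in> {0..1/25} \<and> overlap (\<alpha> * mean_F2 U q) = q" (is "\<exists>!q. ?fixp U q")
    and ex1': "\<forall>\<^sub>F \<eta> in X. \<exists>!q. q \<in> {0..1/25} \<and> overlap (\<alpha> * mean_F2 (V \<eta>) q) = q"
    and lip: "\<forall>\<^sub>F \<eta> in X. \<forall>q\<in>{0..1/25}. \<forall>q'\<in>{0..1/25}.
      \<alpha> * \<bar>mean_F2 (V \<eta>) q - mean_F2 (V \<eta>) q'\<bar> \<le> 1 / 2 * \<bar>q - q'\<bar>"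
    and lim: "((\<lambda>\<eta>. mean_F2 (V \<eta>) (rs_overlap \<alpha> U)) \<longlongrightarrow> mean_F2 U (rs_overlap \<alpha> U)) X"
    and \<alpha>: "0 \<le> \<alpha>"
  shows "((\<lambda>\<eta>. rs_overlap \<alpha> (V \<eta>)) \<longlongrightarrow> rs_overlap \<alpha> U) X"
proof -
  define q0 where "q0 = rs_overlap \<alpha> U"
  have q0: "?fixp U q0"
    unfolding q0_def rs_overlap_def by (rule theI'[OF ex1])
  have close: "\<forall>\<^sub>F \<eta> in X. norm (rs_overlap \<alpha> (V \<eta>) - q0) \<le> 2 * (\<alpha> * \<bar>mean_F2 (V \<eta>) q0 - mean_F2 U q0\<bar>)"
    using ex1' lip
  proof eventually_elim
    case (elim \<eta>)
    define q where "q = rs_overlap \<alpha> (V \<eta>)"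
    have q: "?fixp (V \<eta>) q"
      unfolding q_def rs_overlap_def by (rule theI'[OF elim(1)])
    have "\<bar>q - q0\<bar> = \<bar>overlap (\<alpha> * mean_F2 (V \<eta>) q) - overlap (\<alpha> * mean_F2 U q0)\<bar>"
      using q q0 by simp
    also have "\<dots> \<le> \<bar>\<alpha> * mean_F2 (V \<eta>) q - \<alpha> * mean_F2 U q0\<bar>"
      using \<alpha> by (intro overlap_lipschitz mult_nonneg_nonneg mean_F2_nonneg)
    also have "\<dots> = \<alpha> * \<bar>mean_F2 (V \<eta>) q - mean_F2 U q0\<bar>"
      using \<alpha> by (simp add: abs_mult flip: right_diff_distrib)
    also have "\<dots> \<le> \<alpha> * (\<bar>mean_F2 (V \<eta>) q - mean_F2 (V \<eta>) q0\<bar> + \<bar>mean_F2 (V \<eta>) q0 - mean_F2 U q0\<bar>)"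
      using \<alpha> by (intro mult_left_mono) auto
    also have "\<dots> \<le> 1 / 2 * \<bar>q - q0\<bar> + \<alpha> * \<bar>mean_F2 (V \<eta>) q0 - mean_F2 U q0\<bar>"
      using elim(2) q q0 by (simp add: distrib_left)
    finally show ?case
      by (simp add: q_def)
  qed
  have "((\<lambda>\<eta>. 2 * (\<alpha> * \<bar>mean_F2 (V \<eta>) q0 - mean_F2 U q0\<bar>)) \<longlongrightarrow>
      2 * (\<alpha> * \<bar>mean_F2 U q0 - mean_F2 U q0\<bar>)) X"
    using lim unfolding q0_def by (intro tendsto_intros)
  then have "((\<lambda>\<eta>. 2 * (\<alpha> * \<bar>mean_F2 (V \<eta>) q0 - mean_F2 U q0\<bar>)) \<longlongrightarrow> 0) X"
    by simp
  with close have "((\<lambda>\<eta>. rs_overlap \<alpha> (V \<eta>) - q0) \<longlongrightarrow> 0) X"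
    by (rule Lim_null_comparison)
  then show ?thesis
    unfolding q0_def by (rule LIM_zero_cancel)
qed

theorem proposition1p9:
  fixes U :: "real \<Rightarrow> real" and \<alpha> c0 c1 :: real
  assumes "admissible_c0 c0" and "admissible_c1 c0 c1"
    and "assumption1 U"
    and "0 \<le> \<alpha>" and "\<alpha> \<le> alpha' c0 c1 U"
  shows "((\<lambda>\<eta>. RS \<alpha> (smoothed \<eta> U)) \<longlongrightarrow> RS \<alpha> U) (at_right 0)"
proof -
  note c1 = \<open>admissible_c1 c0 c1\<close> and A = \<open>assumption1 U\<close> and \<alpha> = \<open>0 \<le> \<alpha>\<close>
  have c0: "5 \<le> c0" using assms(1) by (simp add: admissible_c0_def)
  have c1_ge: "1 \<le> c1" using c1 by (simp add: admissible_c1_def)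
  have small: "\<alpha> * (c1 * C1 c0 U ^ 6) \<le> 1 / 65536"
    using c0 c1_ge \<alpha> assms(5) by (rule alpha'_small)
  then have small_U: "\<alpha> * (c1 * C1 c0 U ^ 6) \<le> 1 / 50"
    by simp
  have c0_pos: "0 < c0" using c0 by simp
  have good: "\<forall>\<^sub>F \<eta> in at_right 0.
      assumption1 (smoothed \<eta> U) \<and> \<alpha> * (c1 * C1 c0 (smoothed \<eta> U) ^ 6) \<le> 1 / 50"
    using eventually_assumption1_smoothed[OF A] eventually_C1_smoothed_le[OF A c0_pos]
  proof eventually_elim
    case (elim \<eta>)
    \<comment> \<open>The smallness constant loses a factor \<open>2 ^ 6 = 64\<close>, and \<open>64 / 2 ^ 16 \<le> 1 / 50\<close>.\<close>
    have "C1 c0 (smoothed \<eta> U) ^ 6 \<le> (2 * C1 c0 U) ^ 6"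
      using elim C1_bounds(2)[OF c0, of "smoothed \<eta> U"] c0 by (intro power_mono) auto
    then have "\<alpha> * (c1 * C1 c0 (smoothed \<eta> U) ^ 6) \<le> \<alpha> * (c1 * (2 * C1 c0 U) ^ 6)"
      using \<alpha> c1_ge by (intro mult_left_mono) auto
    also have "\<dots> = 64 * (\<alpha> * (c1 * C1 c0 U ^ 6))"
      by (simp add: power_mult_distrib)
    finally show ?case
      using elim small by simp
  qed
  let ?q = "\<lambda>\<eta>. rs_overlap \<alpha> (smoothed \<eta> U)" and ?qU = "rs_overlap \<alpha> U"
  let ?\<psi> = "\<lambda>\<eta>. \<alpha> * mean_F2 (smoothed \<eta> U) (?q \<eta>)" and ?\<psi>U = "\<alpha> * mean_F2 U ?qU"
  note ex1_U = rs_overlap_ex1[OF c0 c1 A \<alpha> small_U]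
  have q0: "?qU \<in> {0..1/25}"
    using theI'[OF ex1_U] by (simp add: rs_overlap_def)
  have ex1: "\<forall>\<^sub>F \<eta> in at_right 0. \<exists>!q. q \<in> {0..1/25} \<and> overlap (\<alpha> * mean_F2 (smoothed \<eta> U) q) = q"
    using good by eventually_elim (use rs_overlap_ex1[OF c0 c1 _ \<alpha>] in blast)
  have q: "\<forall>\<^sub>F \<eta> in at_right 0. ?q \<eta> \<in> {0..1/25}"
    using ex1 by eventually_elim (drule theI', simp add: rs_overlap_def)
  have lim: "((\<lambda>\<eta>. mean_L (smoothed \<eta> U) ?qU) \<longlongrightarrow> mean_L U ?qU) (at_right 0)"
      "((\<lambda>\<eta>. mean_F2 (smoothed \<eta> U) ?qU) \<longlongrightarrow> mean_F2 U ?qU) (at_right 0)"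
    using tendsto_mean_L_mean_F2[OF A, of ?qU] q0 by simp_all
  have "\<forall>\<^sub>F \<eta> in at_right 0. \<forall>q\<in>{0..1/25}. \<forall>q'\<in>{0..1/25}.
      \<alpha> * \<bar>mean_F2 (smoothed \<eta> U) q - mean_F2 (smoothed \<eta> U) q'\<bar> \<le> 1 / 2 * \<bar>q - q'\<bar>"
    using good by eventually_elim (use small_load_bounds(1)[OF c0 c1 _ \<alpha>] in blast)
  then have lim_q: "(?q \<longlongrightarrow> ?qU) (at_right 0)"
    by (rule tendsto_rs_overlap[OF ex1_U ex1 _ lim(2) \<alpha>])
  have "\<forall>\<^sub>F \<eta> in at_right 0.
      \<alpha> * \<bar>mean_F2 (smoothed \<eta> U) (?q \<eta>) - mean_F2 (smoothed \<eta> U) ?qU\<bar> \<le> 1 / 2 * \<bar>?q \<eta> - ?qU\<bar>"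
    using good q by eventually_elim (use q0 small_load_bounds(1)[OF c0 c1 _ \<alpha>] in blast)
  then have lim_\<psi>: "(?\<psi> \<longlongrightarrow> ?\<psi>U) (at_right 0)"
    by (rule tendsto_at_moving_point[where f="\<lambda>\<eta>. mean_F2 (smoothed \<eta> U)", OF _ lim_q lim(2) \<alpha>])
  have "\<forall>\<^sub>F \<eta> in at_right 0.
      \<alpha> * \<bar>mean_L (smoothed \<eta> U) (?q \<eta>) - mean_L (smoothed \<eta> U) ?qU\<bar> \<le> 1 / 2 * \<bar>?q \<eta> - ?qU\<bar>"
    using good q by eventually_elim (use q0 small_load_bounds(2)[OF c0 c1 _ \<alpha>] in blast)
  then have lim_L: "((\<lambda>\<eta>. \<alpha> * mean_L (smoothed \<eta> U) (?q \<eta>)) \<longlongrightarrow> \<alpha> * mean_L U ?qU) (at_right 0)"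
    by (rule tendsto_at_moving_point[where f="\<lambda>\<eta>. mean_L (smoothed \<eta> U)", OF _ lim_q lim(1) \<alpha>])
  have "((\<lambda>\<eta>. mean_ln_cosh (?\<psi> \<eta>) - mean_ln_cosh ?\<psi>U) \<longlongrightarrow> 0) (at_right 0)"
  proof (rule Lim_null_comparison)
    show "\<forall>\<^sub>F \<eta> in at_right 0. norm (mean_ln_cosh (?\<psi> \<eta>) - mean_ln_cosh ?\<psi>U) \<le> 1 / 2 * \<bar>?\<psi> \<eta> - ?\<psi>U\<bar>"
      unfolding real_norm_def using \<alpha>
      by (intro always_eventually allI mean_ln_cosh_lipschitz mult_nonneg_nonneg mean_F2_nonneg)
    have "((\<lambda>\<eta>. 1 / 2 * \<bar>?\<psi> \<eta> - ?\<psi>U\<bar>) \<longlongrightarrow> 1 / 2 * \<bar>?\<psi>U - ?\<psi>U\<bar>) (at_right 0)"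
      by (intro tendsto_intros lim_\<psi>)
    then show "((\<lambda>\<eta>. 1 / 2 * \<bar>?\<psi> \<eta> - ?\<psi>U\<bar>) \<longlongrightarrow> 0) (at_right 0)"
      by simp
  qed
  then have lim_cosh: "((\<lambda>\<eta>. mean_ln_cosh (?\<psi> \<eta>)) \<longlongrightarrow> mean_ln_cosh ?\<psi>U) (at_right 0)"
    by (rule LIM_zero_cancel)
  have "((\<lambda>\<eta>. - (?\<psi> \<eta> * (1 - ?q \<eta>)) / 2 + (mean_ln_cosh (?\<psi> \<eta>) + \<alpha> * mean_L (smoothed \<eta> U) (?q \<eta>)))
      \<longlongrightarrow> - (?\<psi>U * (1 - ?qU)) / 2 + (mean_ln_cosh ?\<psi>U + \<alpha> * mean_L U ?qU)) (at_right 0)"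
    by (intro tendsto_intros lim_\<psi> lim_q lim_cosh lim_L) simp
  moreover have "\<forall>\<^sub>F \<eta> in at_right 0. - (?\<psi> \<eta> * (1 - ?q \<eta>)) / 2 +
      (mean_ln_cosh (?\<psi> \<eta>) + \<alpha> * mean_L (smoothed \<eta> U) (?q \<eta>)) = RS \<alpha> (smoothed \<eta> U)"
    using good ex1 by eventually_elim (rule RS_eq[symmetric], use \<alpha> in auto)
  moreover have "RS \<alpha> U = - (?\<psi>U * (1 - ?qU)) / 2 + (mean_ln_cosh ?\<psi>U + \<alpha> * mean_L U ?qU)"
    by (rule RS_eq[OF A \<alpha> ex1_U refl refl])
  ultimately show ?thesis
    by (simp only: Lim_transform_eventually)
qed

end
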